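(* Let $$p = 2\left(2(\sqrt3-1)\frac{(2(\sqrt3+1))^{1/3}+1}{(2(\sqrt3-1))^{1/3}-1}\right)^{1/3},$$ $a = 2(2(\sqrt3+1))^{1/3} + (2(\sqrt3+1))^{2/3} + \sqrt3+1$, $b = 2\big((2(\sqrt3+1))^{1/3} - (2(\sqrt3-1))^{1/3}\big)$, $c = 2\big((2(\sqrt3-1))^{1/3} - (2(\sqrt3+1))^{1/3} - \sqrt3 - 1\big)$, $d = 2(\sqrt3-1)$, and $$\alpha = \tfrac23\big(a - b\cos\tfrac{\pi}{9} - c\cos\tfrac{2\pi}{9}\big),\quad \beta = \tfrac23\big(a + d\cos\tfrac{\pi}{9} - b\cos\tfrac{2\pi}{9}\big),\quad \gamma = \tfrac23\big(a - c\cos\tfrac{\pi}{9} + d\cos\tfrac{2\pi}{9}\big).$$ Set $u_1 = (\beta p/\alpha)^{1/3}$, $u_2 = (\gamma p/\beta)^{1/3}$, $u_3 = (2(\sqrt3+1))^{1/3}$, $u_4 = (\alpha p/\gamma)^{1/3}$. Then $$\frac{\varphi(e^{-81\pi})}{\varphi(e^{-\pi})} = \frac19(1+u_1+u_2+u_3+u_4).$$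
   Context: $\varphi(q) := \sum_{n=-\infty}^\infty q^{n^2}$ for $|q|<1$. Cube roots of real numbers denote real cube roots.
   Formalization: In c the printed term −√3−1 is replaced by +√3−1, i.e. c = 2((2(√3−1))^{1/3} − (2(√3+1))^{1/3} + √3 − 1); with the printed sign the right side is about 0.92445 while the left side is about 0.92044, so the identity as printed is false. *)

theory Defs
  imports "HOL-Analysis.Analysis"
begin

text \<open>
  Ramanujan's theta function \<open>\<phi>(q) = \<Sum>\<^sub>n q\<^bsup>n\<^sup>2\<^esup>\<close>, summed over all integers \<open>n\<close>. It is meant for
  \<open>norm q < 1\<close>, where the family is absolutely summable; if the family is not summable,
  the value is the default \<open>0\<close> of \<open>infsum\<close>.
\<close>

definition ramanujan_phi :: "'a :: real_normed_field \<Rightarrow> 'a"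
  where "ramanujan_phi q = (\<Sum>\<^sub>\<infinity>n\<in>(UNIV :: int set). q powi (n ^ 2))"

end

theory Submission
  imports Defs "HOL-Probability.Characteristic_Functions"
begin

text \<open>
  Write \<open>\<theta>\<^sub>3(x) = \<Sum>\<^sub>n q\<^bsup>n\<^sup>2\<^esup> cos (2\<pi>nx)\<close> with \<open>q = exp (-\<pi>)\<close>. Averaging \<open>\<theta>\<^sub>3\<close> over the points \<open>k/9\<close> leaves only
  the frequencies divisible by 9, so \<open>9 \<phi>(q\<^bsup>81\<^esup>)\<close> is \<open>\<theta>\<^sub>3(0) + 2 \<Sum>\<^bsub>k=1..4\<^esub> \<theta>\<^sub>3(k/9)\<close> and the claim becomes
  \<open>u\<^sub>k = 2 \<theta>\<^sub>3(k/9) / \<theta>\<^sub>3(0)\<close>. The addition formulas of \<open>\<theta>\<^sub>1\<close> and \<open>\<theta>\<^sub>3\<close> give algebraic relations between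
  these values and the ratios \<open>s\<^sub>k = \<theta>\<^sub>1(k/9) / \<theta>\<^sub>3(k/9)\<close>. They hold for every nome; the special nome enters
  through \<open>\<theta>\<^sub>1(1/2) = \<theta>\<^sub>3(1/2)\<close>, an instance of Poisson summation for the self-dual Gaussian, which
  determines \<open>s\<^sub>3\<close>. Then \<open>s\<^sub>1\<^sup>2\<close>, \<open>s\<^sub>2\<^sup>2\<close>, \<open>s\<^sub>4\<^sup>2\<close> are the roots of a cubic over \<open>\<rat>(B)\<close> with
  \<open>B\<^sup>3 = 2(\<surd>3 - 1)\<close>. The ratios \<open>\<alpha>/\<beta>\<close>, \<open>\<beta>/\<gamma>\<close>, \<open>\<gamma>/\<alpha>\<close> are the roots of the cubic satisfied by
  \<open>(1 + s\<^sub>3\<^sup>2 s\<^sub>k\<^sup>2) / B\<^sup>2\<close>, and comparing the order of the roots identifies the two triples.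
\<close>

section \<open>Poisson summation for the self-dual Gaussian\<close>

lemma summable_exp_abs_int:
  fixes t :: real
  assumes "t > 0"
  shows "(\<lambda>n::int. exp (- t * \<bar>of_int n\<bar>)) summable_on UNIV"
proof -
  have nat: "(\<lambda>n::nat. exp (- t * n)) summable_on UNIV"
  proof -
    have "summable (\<lambda>n::nat. exp (-t) ^ n)"
      using assms by (intro summable_geometric) auto
    moreover have "exp (- t * real n) = exp (- t) ^ n" for n
      by (metis exp_of_nat2_mult mult.commute)
    ultimately show ?thesis
      by (intro norm_summable_imp_summable_on) simp
  qed
  have "(\<lambda>n::int. exp (- t * \<bar>of_int n\<bar>)) summable_on {0..}"
    using nat by (subst summable_on_reindex_bij_witness[where j = nat and i = int and T = UNIV
          and h = "\<lambda>n::nat. exp (- t * n)"]) auto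
  moreover have "(\<lambda>n::int. exp (- t * \<bar>of_int n\<bar>)) summable_on {..0}"
    using nat by (subst summable_on_reindex_bij_witness[where j = "\<lambda>n. nat (-n)"
          and i = "\<lambda>n. - int n" and T = UNIV and h = "\<lambda>n::nat. exp (- t * n)"]) auto
  ultimately have "(\<lambda>n::int. exp (- t * \<bar>of_int n\<bar>)) summable_on ({0..} \<union> {..0})"
    by (rule summable_on_union)
  moreover have "{0..} \<union> {..0} = (UNIV :: int set)"
    by auto
  ultimately show ?thesis
    by simp
qed

text \<open>Expanding (|n + x| - 1/2)^2 >= 0 bounds the square from below by a linear term. The
  constant depends on |x| alone, so for x in a bounded interval the majorant is uniform and can feed
  the M-test.\<close>

lemma gaussian_int_le:
  fixes t x :: real and n :: int
  assumes "t \<ge> 0"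
  shows "exp (- t * (of_int n + x)\<^sup>2) \<le> exp (t * (\<bar>x\<bar> + 1 / 4)) * exp (- t * \<bar>of_int n\<bar>)"
proof -
  have "(\<bar>of_int n + x\<bar> - 1 / 2)\<^sup>2 \<ge> 0"
    by simp
  hence "(of_int n + x)\<^sup>2 \<ge> \<bar>of_int n + x\<bar> - 1 / 4"
    by (simp add: power2_diff power_divide)
  hence "(of_int n + x)\<^sup>2 \<ge> \<bar>of_int n\<bar> - (\<bar>x\<bar> + 1 / 4)"
    by linarith
  hence "t * (\<bar>of_int n\<bar> - (\<bar>x\<bar> + 1 / 4)) \<le> t * (of_int n + x)\<^sup>2"
    using assms by (intro mult_left_mono)
  thus ?thesis
    unfolding exp_add[symmetric] by (simp add: algebra_simps)
qed

lemma summable_gaussian_int: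
  fixes t x :: real
  assumes "t > 0"
  shows "(\<lambda>n::int. exp (- t * (of_int n + x)\<^sup>2)) summable_on UNIV"
proof (rule summable_on_comparison_test)
  show "(\<lambda>n::int. exp (t * (\<bar>x\<bar> + 1 / 4)) * exp (- t * \<bar>of_int n\<bar>)) summable_on UNIV"
    using assms by (intro summable_on_cmult_right summable_exp_abs_int)
qed (use gaussian_int_le[of t _ x] assms in auto)

text \<open>Turns convergence along finite sets into convergence of symmetric partial sums. Uniform
  limits of sequences can be integrated, and the unit intervals around -M, ..., M tile a symmetric
  interval.\<close>

lemma filterlim_symmetric_intervals:
  "filterlim (\<lambda>M::nat. {- int M..int M}) (finite_subsets_at_top UNIV) sequentially"
  unfolding filterlim_finite_subsets_at_top
proof (intro allI impI)
  fix X :: "int set"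
  assume "finite X \<and> X \<subseteq> UNIV"
  hence X: "finite X" by simp
  define N where "N = Max (insert 0 (abs ` X))"
  have N: "\<bar>x\<bar> \<le> N" if "x \<in> X" for x
    unfolding N_def using X that by (intro Max_ge) auto
  have "\<forall>\<^sub>F M in sequentially. nat N \<le> M"
    by (rule eventually_ge_at_top)
  thus "\<forall>\<^sub>F M in sequentially. finite {- int M..int M} \<and> X \<subseteq> {- int M..int M} \<and> {- int M..int M} \<subseteq> UNIV"
  proof eventually_elim
    case (elim M)
    have "x \<in> {- int M..int M}" if "x \<in> X" for x
      using N[OF that] elim by auto
    thus ?case by auto
  qed
qed

text \<open>Evenness makes \<open>D\<close> a continuous function \<open>d\<close> of cos (2 pi x).
  Product-to-sum formulas extend the vanishing to powers, hence to polynomials, of cos (2 pi x).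
  Approximating \<open>d\<close> by polynomials bounds the integral of D^2 by e times the integral
  of |D|, for every e > 0.\<close>

lemma cosine_coeffs_zero_imp_zero:
  fixes D :: "real \<Rightarrow> real"
  assumes cont: "continuous_on {-1/2..1/2} D"
    and even: "\<And>x. D (- x) = D x"
    and coeff: "\<And>j::nat. ((\<lambda>x. D x * cos (2 * pi * real j * x)) has_integral 0) {-1/2..1/2}"
    and x: "x \<in> {-1/2..1/2}"
  shows "D x = 0"
proof -
  have monom: "((\<lambda>x. D x * cos (2 * pi * x) ^ k * cos (2 * pi * real j * x)) has_integral 0) {-1/2..1/2}"
    for k j :: nat
  proof (induction k arbitrary: j)
    case 0
    thus ?case using coeff by simp
  next
    case (Suc k)
    \<comment> \<open>The frequency |j - 1|: at j = 0 the difference is -1, and the cosine is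
      even.\<close>
    define j' where "j' = (if j = 0 then 1 else j - 1)"
    have *: "cos (2 * pi * x) * cos (2 * pi * real j * x) =
          (cos (2 * pi * real (Suc j) * x) + cos (2 * pi * real j' * x)) / 2" for x
    proof -
      have "cos (2 * pi * real j' * x) = cos (2 * pi * real j * x - 2 * pi * x)"
        by (cases j) (auto simp: j'_def algebra_simps)
      moreover have "cos (2 * pi * real (Suc j) * x) = cos (2 * pi * real j * x + 2 * pi * x)"
        by (simp add: algebra_simps)
      ultimately show ?thesis
        by (simp add: cos_add cos_diff)
    qed
    have "((\<lambda>x. (D x * cos (2 * pi * x) ^ k * cos (2 * pi * real (Suc j) * x) +
             D x * cos (2 * pi * x) ^ k * cos (2 * pi * real j' * x)) * (1 / 2))
            has_integral (0 + 0) * (1 / 2)) {-1/2..1/2}"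
      by (intro has_integral_mult_left has_integral_add Suc.IH)
    moreover have "(D x * cos (2 * pi * x) ^ k * cos (2 * pi * real (Suc j) * x) +
             D x * cos (2 * pi * x) ^ k * cos (2 * pi * real j' * x)) * (1 / 2) =
             D x * cos (2 * pi * x) ^ Suc k * cos (2 * pi * real j * x)" for x
    proof -
      have "D x * cos (2 * pi * x) ^ Suc k * cos (2 * pi * real j * x) =
            D x * cos (2 * pi * x) ^ k * (cos (2 * pi * x) * cos (2 * pi * real j * x))"
        by simp
      thus ?thesis unfolding * by (simp add: algebra_simps)
    qed
    ultimately show ?case by simp
  qed
  have poly: "((\<lambda>x. D x * p (cos (2 * pi * x))) has_integral 0) {-1/2..1/2}"
    if "real_polynomial_function p" for p :: "real \<Rightarrow> real"
  proof -
    obtain a n where p: "p = (\<lambda>x. \<Sum>i\<le>n. a i * x ^ i)"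
      using \<open>real_polynomial_function p\<close> by (auto simp: real_polynomial_function_iff_sum)
    have "((\<lambda>x. \<Sum>i\<le>n. a i * (D x * cos (2 * pi * x) ^ i * cos (2 * pi * real 0 * x)))
             has_integral (\<Sum>i\<le>n. a i * 0)) {-1/2..1/2}"
      by (intro has_integral_sum has_integral_mult_right monom) auto
    thus ?thesis
      by (simp add: p sum_distrib_left mult_ac)
  qed
  define d where "d u = D (arccos u / (2 * pi))" for u
  have d: "d (cos (2 * pi * x)) = D x" if "x \<in> {-1/2..1/2}" for x
  proof (cases "x \<ge> 0")
    case True
    hence "arccos (cos (2 * pi * x)) = 2 * pi * x"
      using that by (intro arccos_cos) (auto simp: field_simps)
    thus ?thesis by (simp add: d_def)
  next
    case False
    hence "arccos (cos (2 * pi * (- x))) = 2 * pi * (- x)"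
      using that mult_left_mono[of "2 * (- x)" 1 pi] by (intro arccos_cos) (auto simp: mult_ac mult_nonneg_nonpos)
    thus ?thesis by (simp add: d_def even)
  qed
  have cont_d: "continuous_on {-1..1} d"
    unfolding d_def
  proof (rule continuous_on_compose2[OF cont])
    show "continuous_on {-1..1} (\<lambda>x. arccos x / (2 * pi))"
      by (intro continuous_intros continuous_on_arccos') auto
    show "(\<lambda>x. arccos x / (2 * pi)) ` {- 1..1} \<subseteq> {-1/2..1/2}"
    proof safe
      fix u :: real assume "u \<in> {-1..1}"
      hence "0 \<le> arccos u" "arccos u \<le> pi"
        using arccos_lbound[of u] arccos_ubound[of u] by auto
      moreover have "- pi \<le> 0" by simp
      ultimately show "arccos u / (2 * pi) \<in> {-1/2..1/2}"
        by (auto simp: field_simps intro: order_trans)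
    qed
  qed
  define J where "J = integral {-1/2..1/2} (\<lambda>x. (D x)\<^sup>2)"
  have D2: "(\<lambda>x. (D x)\<^sup>2) integrable_on {-1/2..1/2}"
    by (intro integrable_continuous_interval continuous_intros cont)
  define I where "I = integral {-1/2..1/2} (\<lambda>x. \<bar>D x\<bar>)"
  have D1: "(\<lambda>x. \<bar>D x\<bar>) integrable_on {-1/2..1/2}"
    by (intro integrable_continuous_interval continuous_intros cont)
  have "I \<ge> 0" unfolding I_def by (intro integral_nonneg D1) auto
  have bound: "J \<le> e * I" if e: "e > 0" for e
  proof -
    obtain p where p: "real_polynomial_function p" "\<And>u. u \<in> {-1..1} \<Longrightarrow> \<bar>d u - p u\<bar> < e"
      using Stone_Weierstrass_real_polynomial_function[OF _ cont_d e] by blast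
    have "((\<lambda>x. (D x)\<^sup>2 - D x * p (cos (2 * pi * x))) has_integral J - 0) {-1/2..1/2}"
      unfolding J_def by (intro has_integral_diff poly p integrable_integral D2)
    moreover have "((\<lambda>x. e * \<bar>D x\<bar>) has_integral e * I) {-1/2..1/2}"
      unfolding I_def by (intro has_integral_mult_right integrable_integral D1)
    moreover have "(D x)\<^sup>2 - D x * p (cos (2 * pi * x)) \<le> e * \<bar>D x\<bar>" if "x \<in> {-1/2..1/2}" for x
    proof -
      have "\<bar>D x - p (cos (2 * pi * x))\<bar> < e"
        using p(2)[of "cos (2 * pi * x)"] d[OF that] by simp
      hence "\<bar>D x\<bar> * \<bar>D x - p (cos (2 * pi * x))\<bar> \<le> \<bar>D x\<bar> * e"
        by (intro mult_left_mono) auto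
      hence "\<bar>D x * (D x - p (cos (2 * pi * x)))\<bar> \<le> e * \<bar>D x\<bar>"
        by (simp add: abs_mult mult_ac)
      thus ?thesis
        by (simp add: power2_eq_square algebra_simps)
    qed
    ultimately show ?thesis
      by (metis (no_types, lifting) has_integral_le diff_zero)
  qed
  have "J \<le> 0"
  proof (rule field_le_epsilon)
    fix e :: real assume "e > 0"
    have "J \<le> e / (I + 1) * I"
      using \<open>e > 0\<close> \<open>I \<ge> 0\<close> by (intro bound) auto
    also have "\<dots> \<le> e"
      using \<open>e > 0\<close> \<open>I \<ge> 0\<close> by (simp add: field_simps)
    finally show "J \<le> 0 + e" by simp
  qed
  moreover have "J \<ge> 0" unfolding J_def by (intro integral_nonneg D2) auto
  ultimately have "((\<lambda>x. (D x)\<^sup>2) has_integral 0) (cbox (-1/2) (1/2))"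
    using D2 unfolding J_def by (simp add: has_integral_iff)
  hence "(D x)\<^sup>2 = 0"
    by (rule has_integral_0_cbox_imp_0[rotated 2])
       (use cont x in \<open>auto intro!: continuous_intros\<close>)
  thus ?thesis by simp
qed

text \<open>This self-duality under the Fourier transform is the characteristic function of the
  standard normal distribution, rescaled by sqrt (2 pi), in its real part.\<close>

lemma gaussian_cos_has_integral:
  fixes j :: real
  shows "((\<lambda>x. exp (- pi * x\<^sup>2) * cos (2 * pi * j * x)) has_integral exp (- pi * j\<^sup>2)) UNIV"
proof -
  define c where "c = sqrt (2 * pi)"
  have c: "c > 0" "c\<^sup>2 = 2 * pi"
    by (auto simp: c_def)
  define \<tau> where "\<tau> = 2 * pi * j / c"
  have \<tau>: "\<tau> * c = 2 * pi * j" "\<tau>\<^sup>2 / 2 = pi * j\<^sup>2"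
    using c by (simp_all add: \<tau>_def power_divide power_mult_distrib power2_eq_square)
  interpret real_distribution std_normal_distribution
    by (rule real_dist_normal_dist)
  have int: "integrable std_normal_distribution (\<lambda>x. iexp (\<tau> * x))"
    by (rule integrable_iexp) simp_all
  have "has_bochner_integral std_normal_distribution (\<lambda>x. iexp (\<tau> * x)) (complex_of_real (exp (- (\<tau>\<^sup>2) / 2)))"
    using has_bochner_integral_integrable[OF int] fun_cong[OF char_std_normal_distribution, of \<tau>]
    unfolding char_def by (simp only:)
  hence "has_bochner_integral std_normal_distribution (\<lambda>x. Re (iexp (\<tau> * x))) (exp (- (\<tau>\<^sup>2) / 2))"
    by (metis Re_complex_of_real has_bochner_integral_Re)
  hence "has_bochner_integral lborel (\<lambda>x. std_normal_density x *\<^sub>R cos (\<tau> * x)) (exp (- (\<tau>\<^sup>2) / 2))"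
    by (simp add: has_bochner_integral_iff integrable_density integral_density Re_exp)
  hence "has_bochner_integral lborel (\<lambda>x. std_normal_density (0 + c * x) *\<^sub>R cos (\<tau> * (0 + c * x)))
            (exp (- (\<tau>\<^sup>2) / 2) /\<^sub>R \<bar>c\<bar>)"
    using c by (subst (asm) lborel_has_bochner_integral_real_affine_iff[where c = c and t = 0]) auto
  hence scaled: "has_bochner_integral lborel
           (\<lambda>x. c * (std_normal_density (0 + c * x) *\<^sub>R cos (\<tau> * (0 + c * x))))
           (c * (exp (- (\<tau>\<^sup>2) / 2) /\<^sub>R \<bar>c\<bar>))"
    by (intro has_bochner_integral_mult_right)
  have integrand: "c * (std_normal_density (0 + c * x) *\<^sub>R cos (\<tau> * (0 + c * x))) =
                   exp (- pi * x\<^sup>2) * cos (2 * pi * j * x)" for x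
  proof -
    have arg: "\<tau> * (0 + c * x) = 2 * pi * j * x"
      using \<tau>(1) by (simp flip: mult.assoc)
    have "c * std_normal_density (0 + c * x) = exp (- pi * x\<^sup>2)"
      using c by (simp add: std_normal_density_def power_mult_distrib flip: c_def)
    thus ?thesis
      unfolding arg by simp
  qed
  have val: "c * (exp (- (\<tau>\<^sup>2) / 2) /\<^sub>R \<bar>c\<bar>) = exp (- pi * j\<^sup>2)"
    using \<tau>(2) c(1) by simp
  have "has_bochner_integral lborel (\<lambda>x. exp (- pi * x\<^sup>2) * cos (2 * pi * j * x)) (exp (- pi * j\<^sup>2))"
    using scaled unfolding integrand val .
  thus ?thesis
    using has_integral_integral_lborel[of "\<lambda>x. exp (- pi * x\<^sup>2) * cos (2 * pi * j * x)"]
    by (auto simp: has_bochner_integral_iff)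
qed

text \<open>Both claims come from the M-test with majorant \<open>B\<close>. Termwise integration is
  what computes the cosine coefficients of the two sides of Poisson summation.\<close>

lemma infsum_int_uniform_integral:
  fixes f :: "int \<Rightarrow> real \<Rightarrow> real" and B :: "int \<Rightarrow> real"
  assumes cont: "\<And>n. continuous_on {a..b} (f n)"
    and bound: "\<And>n x. x \<in> {a..b} \<Longrightarrow> \<bar>f n x\<bar> \<le> B n"
    and B: "B summable_on UNIV"
  shows "continuous_on {a..b} (\<lambda>x. \<Sum>\<^sub>\<infinity>n. f n x)"
    and "(\<lambda>M::nat. \<Sum>n\<in>{- int M..int M}. integral {a..b} (f n))
           \<longlonglongrightarrow> integral {a..b} (\<lambda>x. \<Sum>\<^sub>\<infinity>n. f n x)"
proof -
  have "uniform_limit {a..b} (\<lambda>X x. \<Sum>n\<in>X. f n x) (\<lambda>x. \<Sum>\<^sub>\<infinity>n. f n x) (finite_subsets_at_top UNIV)"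
    using bound B by (intro Weierstrass_m_test_general[where M = B]) auto
  hence lim: "uniform_limit {a..b} (\<lambda>(M::nat) x. \<Sum>n\<in>{- int M..int M}. f n x)
           (\<lambda>x. \<Sum>\<^sub>\<infinity>n. f n x) sequentially"
    by (rule filterlim_compose[OF _ filterlim_symmetric_intervals])
  have cont': "continuous_on {a..b} (\<lambda>x. \<Sum>n\<in>{- int M..int M}. f n x)" for M
    by (intro continuous_intros cont)
  show "continuous_on {a..b} (\<lambda>x. \<Sum>\<^sub>\<infinity>n. f n x)"
    by (rule uniform_limit_theorem[OF _ lim]) (auto intro!: always_eventually cont')
  obtain I J where I: "\<And>M. ((\<lambda>x. \<Sum>n\<in>{- int M..int M}. f n x) has_integral I M) {a..b}"
    and J: "((\<lambda>x. \<Sum>\<^sub>\<infinity>n. f n x) has_integral J) {a..b}" and IJ: "I \<longlonglongrightarrow> J"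
    using uniform_limit_integral[OF lim cont'] by auto
  have "I = (\<lambda>M. \<Sum>n\<in>{- int M..int M}. integral {a..b} (f n))"
  proof
    fix M
    have "integral {a..b} (\<lambda>x. \<Sum>n\<in>{- int M..int M}. f n x) = (\<Sum>n\<in>{- int M..int M}. integral {a..b} (f n))"
      by (intro integral_sum) (auto intro!: integrable_continuous_interval cont)
    thus "I M = (\<Sum>n\<in>{- int M..int M}. integral {a..b} (f n))"
      using integral_unique[OF I[of M]] by simp
  qed
  thus "(\<lambda>M::nat. \<Sum>n\<in>{- int M..int M}. integral {a..b} (f n))
           \<longlonglongrightarrow> integral {a..b} (\<lambda>x. \<Sum>\<^sub>\<infinity>n. f n x)"
    using IJ by (simp add: integral_unique[OF J])
qed

lemma integral_cos_period:
  fixes k :: int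
  shows "((\<lambda>x. cos (2 * pi * of_int k * x)) has_integral (if k = 0 then 1 else 0)) {-1/2..1/2}"
proof (cases "k = 0")
  case True
  thus ?thesis
    using has_integral_const_real[of "1::real" "-1/2" "1/2"] by simp
next
  case False
  have "((\<lambda>x. cos (2 * pi * of_int k * x)) has_integral
          (sin (2 * pi * of_int k * (1/2)) / (2 * pi * of_int k) -
           sin (2 * pi * of_int k * (-1/2)) / (2 * pi * of_int k))) {-1/2..1/2}"
  proof (rule fundamental_theorem_of_calculus)
    fix x :: real
    show "((\<lambda>x. sin (2 * pi * of_int k * x) / (2 * pi * of_int k)) has_vector_derivative
            cos (2 * pi * of_int k * x)) (at x within {-1/2..1/2})"
      using False by (auto intro!: derivative_eq_intros
          simp flip: has_real_derivative_iff_has_vector_derivative)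
  qed auto
  moreover have "sin (2 * pi * of_int k * (1/2)) = 0" "sin (2 * pi * of_int k * (-1/2)) = 0"
    by (simp_all add: sin_times_pi_eq_0 mult.commute[of pi])
  ultimately show ?thesis using False by simp
qed

lemma cos_shift_int:
  fixes k m :: int
  shows "cos (2 * pi * of_int k * (x + of_int m)) = cos (2 * pi * of_int k * x)"
proof -
  have "2 * pi * of_int k * (x + of_int m) = 2 * pi * of_int k * x + 2 * pi * of_int (k * m)"
    by (simp add: algebra_simps)
  thus ?thesis
    by (simp add: cos_add sin_integer_2pi cos_integer_2pi del: of_int_mult)
qed

text \<open>Both sides are even and continuous, so it suffices to compare cosine coefficients. On
  the left the translates of the unit interval fill the line and give the Fourier integral of the
  Gaussian; on the right orthogonality selects the frequencies j and -j. Both yield exp (-pi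
  j^2).\<close>

theorem gaussian_poisson_summation:
  fixes x :: real
  assumes "x \<in> {-1/2..1/2}"
  shows "(\<Sum>\<^sub>\<infinity>n::int. exp (- pi * (of_int n + x)\<^sup>2)) =
         (\<Sum>\<^sub>\<infinity>n::int. exp (- pi * (of_int n)\<^sup>2) * cos (2 * pi * of_int n * x))"
proof -
  define F where "F x = (\<Sum>\<^sub>\<infinity>n::int. exp (- pi * (of_int n + x)\<^sup>2))" for x :: real
  define G where "G x = (\<Sum>\<^sub>\<infinity>n::int. exp (- pi * (of_int n)\<^sup>2) * cos (2 * pi * of_int n * x))" for x :: real
  define BF where "BF n = exp (pi * (1 / 2 + 1 / 4)) * exp (- pi * \<bar>of_int n\<bar>)" for n :: int
  define BG where "BG n = exp (- pi * (of_int n)\<^sup>2)" for n :: int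
  have BF: "BF summable_on UNIV"
    unfolding BF_def by (intro summable_on_cmult_right summable_exp_abs_int) simp
  have BG: "BG summable_on UNIV"
    unfolding BG_def using summable_gaussian_int[of pi 0] by simp
  \<comment> \<open>The free \<open>y\<close> covers two uses: y = 0 for \<open>F\<close> itself and
    y = 2 pi j x for its coefficient integrals.\<close>
  have boundF: "\<bar>exp (- pi * (of_int n + x)\<^sup>2) * cos y\<bar> \<le> BF n" if "x \<in> {-1/2..1/2}" for n x y
  proof -
    have "\<bar>exp (- pi * (of_int n + x)\<^sup>2) * cos y\<bar> \<le> exp (- pi * (of_int n + x)\<^sup>2) * 1"
      unfolding abs_mult by (intro mult_mono) auto
    also have "\<dots> \<le> exp (pi * (\<bar>x\<bar> + 1 / 4)) * exp (- pi * \<bar>of_int n\<bar>)"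
      using gaussian_int_le[of pi n x] by simp
    also have "\<dots> \<le> BF n"
      unfolding BF_def using that by (intro mult_right_mono) auto
    finally show ?thesis .
  qed
  have boundG: "\<bar>exp (- pi * (of_int n)\<^sup>2) * cos y\<bar> \<le> BG n" for n y
    unfolding abs_mult BG_def by (rule order.trans[OF mult_left_mono[of _ 1]]) auto
  have boundG': "\<bar>exp (- pi * (of_int n)\<^sup>2) * cos y * cos z\<bar> \<le> BG n" for n y z
  proof -
    have "\<bar>exp (- pi * (of_int n)\<^sup>2) * cos y\<bar> * \<bar>cos z\<bar> \<le> BG n * 1"
      by (intro mult_mono boundG) (auto simp: BG_def)
    thus ?thesis by (simp add: abs_mult)
  qed
  have contF: "continuous_on {-1/2..1/2} F"
    unfolding F_def
    by (rule infsum_int_uniform_integral[OF _ _ BF])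
       (use boundF[of _ _ 0] in \<open>auto intro!: continuous_intros\<close>)
  have contG: "continuous_on {-1/2..1/2} G"
    unfolding G_def
    by (rule infsum_int_uniform_integral[OF _ _ BG])
       (use boundG in \<open>auto intro!: continuous_intros\<close>)
  have evenF: "F (- x) = F x" for x
    unfolding F_def by (rule infsum_reindex_bij_witness[of _ uminus uminus]) (auto simp: power2_eq_square algebra_simps)
  have evenG: "G (- x) = G x" for x
    unfolding G_def by simp

  have coeffF: "integral {-1/2..1/2} (\<lambda>x. F x * cos (2 * pi * real j * x)) = exp (- pi * real j ^ 2)" for j
  proof -
    define h where "h x = exp (- pi * x\<^sup>2) * cos (2 * pi * real j * x)" for x
    have conth: "continuous_on A h" for A
      unfolding h_def by (intro continuous_intros)
    have inth: "h integrable_on {a..b}" for a b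
      by (intro integrable_continuous_interval conth)
    have "F x * cos (2 * pi * real j * x) =
             (\<Sum>\<^sub>\<infinity>n::int. exp (- pi * (of_int n + x)\<^sup>2) * cos (2 * pi * real j * x))" for x
      unfolding F_def by (rule infsum_cmult_left'[symmetric])
    moreover have "(\<lambda>M::nat. \<Sum>n\<in>{- int M..int M}. integral {-1/2..1/2}
             (\<lambda>x. exp (- pi * (of_int n + x)\<^sup>2) * cos (2 * pi * real j * x)))
           \<longlonglongrightarrow> integral {-1/2..1/2} (\<lambda>x. \<Sum>\<^sub>\<infinity>n::int. exp (- pi * (of_int n + x)\<^sup>2) * cos (2 * pi * real j * x))"
      by (rule infsum_int_uniform_integral[OF _ _ BF]) (use boundF in \<open>auto intro!: continuous_intros\<close>)
    moreover have "(\<Sum>n\<in>{- int M..int M}. integral {-1/2..1/2}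
             (\<lambda>x. exp (- pi * (of_int n + x)\<^sup>2) * cos (2 * pi * real j * x))) =
          integral {-(real M + 1/2)..real M + 1/2} h" for M
    proof -
      \<comment> \<open>Shifting by the integer n leaves the cosine unchanged and moves the interval
        to the one centred at n; for |n| <= M these intervals adjoin.\<close>
      have *: "integral {-1/2..1/2} (\<lambda>x. exp (- pi * (of_int n + x)\<^sup>2) * cos (2 * pi * real j * x)) =
              integral {of_int n - 1/2..of_int n + 1/2} h" for n
        using integral_shift[of "-1/2" "of_int n" "1/2" h] conth cos_shift_int[of "int j" _ n]
        by (simp add: h_def o_def algebra_simps)
      show ?thesis
        unfolding *
      proof (induction M)
        case (Suc M)
        have "{- int (Suc M)..int (Suc M)} = insert (int (Suc M)) (insert (- int (Suc M)) {- int M..int M})"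
          by auto
        hence e: "(\<Sum>n\<in>{- int (Suc M)..int (Suc M)}. integral {of_int n - 1/2..of_int n + 1/2} h) =
               integral {real (Suc M) - 1/2..real (Suc M) + 1/2} h +
               (integral {- real (Suc M) - 1/2..- real (Suc M) + 1/2} h +
                integral {-(real M + 1/2)..real M + 1/2} h)"
          by (simp add: Suc.IH)
        have r: "real (Suc M) - 1/2 = real M + 1/2" "- real (Suc M) + 1/2 = -(real M + 1/2)"
            "- real (Suc M) - 1/2 = -(real (Suc M) + 1/2)"
          by simp_all
        have c1: "integral {-(real (Suc M) + 1/2)..-(real M + 1/2)} h +
            integral {-(real M + 1/2)..real M + 1/2} h = integral {-(real (Suc M) + 1/2)..real M + 1/2} h"
          by (intro Henstock_Kurzweil_Integration.integral_combine inth) auto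
        have c2: "integral {-(real (Suc M) + 1/2)..real M + 1/2} h +
            integral {real M + 1/2..real (Suc M) + 1/2} h = integral {-(real (Suc M) + 1/2)..real (Suc M) + 1/2} h"
          by (intro Henstock_Kurzweil_Integration.integral_combine inth) auto
        show ?case unfolding e r using c1 c2 by linarith
      qed simp
    qed
    ultimately have lim1: "(\<lambda>M::nat. integral {-(real M + 1/2)..real M + 1/2} h)
        \<longlonglongrightarrow> integral {-1/2..1/2} (\<lambda>x. F x * cos (2 * pi * real j * x))"
      by simp
    have "(\<lambda>M::nat. integral {-(real M + 1/2)..real M + 1/2} h) \<longlonglongrightarrow> exp (- pi * real j ^ 2)"
    proof (rule LIMSEQ_I)
      fix e :: real assume "e > 0"
      have "(h has_integral exp (- pi * real j ^ 2)) UNIV"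
        unfolding h_def by (rule gaussian_cos_has_integral)
      then obtain R where R: "R > 0" "\<And>a b. ball 0 R \<subseteq> cbox a b \<Longrightarrow>
          norm (integral (cbox a b) h - exp (- pi * real j ^ 2)) < e"
        using \<open>e > 0\<close> unfolding has_integral_alt'[of h _ UNIV] by auto
      have "norm (integral {-(real M + 1/2)..real M + 1/2} h - exp (- pi * real j ^ 2)) < e"
        if "M \<ge> nat \<lceil>R\<rceil>" for M
      proof -
        have "R \<le> real M" using that by linarith
        hence "ball 0 R \<subseteq> cbox (-(real M + 1/2)) (real M + 1/2)"
          by (auto simp: dist_real_def)
        thus ?thesis using R(2) by simp
      qed
      thus "\<exists>no. \<forall>M\<ge>no. norm (integral {-(real M + 1/2)..real M + 1/2} h - exp (- pi * real j ^ 2)) < e"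
        by blast
    qed
    thus ?thesis using lim1 LIMSEQ_unique by blast
  qed

  have coeffG: "integral {-1/2..1/2} (\<lambda>x. G x * cos (2 * pi * real j * x)) = exp (- pi * real j ^ 2)" for j
  proof -
    have "G x * cos (2 * pi * real j * x) =
             (\<Sum>\<^sub>\<infinity>n::int. exp (- pi * (of_int n)\<^sup>2) * cos (2 * pi * of_int n * x) * cos (2 * pi * real j * x))" for x
      unfolding G_def by (rule infsum_cmult_left'[symmetric])
    moreover have "(\<lambda>M::nat. \<Sum>n\<in>{- int M..int M}. integral {-1/2..1/2}
             (\<lambda>x. exp (- pi * (of_int n)\<^sup>2) * cos (2 * pi * of_int n * x) * cos (2 * pi * real j * x)))
           \<longlonglongrightarrow> integral {-1/2..1/2} (\<lambda>x. \<Sum>\<^sub>\<infinity>n::int. exp (- pi * (of_int n)\<^sup>2) * cos (2 * pi * of_int n * x) * cos (2 * pi * real j * x))"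
      by (rule infsum_int_uniform_integral[OF _ _ BG]) (use boundG' in \<open>auto intro!: continuous_intros\<close>)
    moreover have "(\<Sum>n\<in>{- int M..int M}. integral {-1/2..1/2}
             (\<lambda>x. exp (- pi * (of_int n)\<^sup>2) * cos (2 * pi * of_int n * x) * cos (2 * pi * real j * x))) =
             exp (- pi * real j ^ 2)" if "M \<ge> j" for M
    proof -
      \<comment> \<open>For j = 0 both indicators hold at n = 0, and the two halves add up to the
        full coefficient.\<close>
      have *: "integral {-1/2..1/2} (\<lambda>x. exp (- pi * (of_int n)\<^sup>2) * cos (2 * pi * of_int n * x) * cos (2 * pi * real j * x)) =
            exp (- pi * (of_int n)\<^sup>2) / 2 * (if n = - int j then 1 else 0) +
            exp (- pi * (of_int n)\<^sup>2) / 2 * (if n = int j then 1 else 0)" for n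
      proof (rule integral_unique)
        have "((\<lambda>x. exp (- pi * (of_int n)\<^sup>2) / 2 * cos (2 * pi * of_int (n + int j) * x) +
                    exp (- pi * (of_int n)\<^sup>2) / 2 * cos (2 * pi * of_int (n - int j) * x)) has_integral
               exp (- pi * (of_int n)\<^sup>2) / 2 * (if n + int j = 0 then 1 else 0) +
               exp (- pi * (of_int n)\<^sup>2) / 2 * (if n - int j = 0 then 1 else 0)) {-1/2..1/2}"
          by (intro has_integral_add has_integral_mult_right integral_cos_period)
        moreover have "exp (- pi * (of_int n)\<^sup>2) / 2 * cos (2 * pi * of_int (n + int j) * x) +
                    exp (- pi * (of_int n)\<^sup>2) / 2 * cos (2 * pi * of_int (n - int j) * x) =
            exp (- pi * (of_int n)\<^sup>2) * cos (2 * pi * of_int n * x) * cos (2 * pi * real j * x)" for x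
          by (simp add: distrib_left distrib_right left_diff_distrib right_diff_distrib cos_add cos_diff)
        ultimately show "((\<lambda>x. exp (- pi * (of_int n)\<^sup>2) * cos (2 * pi * of_int n * x) * cos (2 * pi * real j * x))
            has_integral exp (- pi * (of_int n)\<^sup>2) / 2 * (if n = - int j then 1 else 0) +
            exp (- pi * (of_int n)\<^sup>2) / 2 * (if n = int j then 1 else 0)) {-1/2..1/2}"
          by (simp add: eq_neg_iff_add_eq_0)
      qed
      show ?thesis
        unfolding * sum.distrib using that by (simp add: mult_ac if_distrib sum.delta' sum.delta cong: if_cong)
    qed
    hence "\<forall>\<^sub>F M in sequentially. (\<Sum>n\<in>{- int M..int M}. integral {-1/2..1/2}
             (\<lambda>x. exp (- pi * (of_int n)\<^sup>2) * cos (2 * pi * of_int n * x) * cos (2 * pi * real j * x))) =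
             exp (- pi * real j ^ 2)"
      by (rule eventually_mono[OF eventually_ge_at_top[of j]])
    hence "(\<lambda>M::nat. \<Sum>n\<in>{- int M..int M}. integral {-1/2..1/2}
             (\<lambda>x. exp (- pi * (of_int n)\<^sup>2) * cos (2 * pi * of_int n * x) * cos (2 * pi * real j * x)))
           \<longlonglongrightarrow> exp (- pi * real j ^ 2)"
      by (rule tendsto_eventually)
    ultimately show ?thesis using LIMSEQ_unique by simp
  qed

  have "F x - G x = 0"
  proof (rule cosine_coeffs_zero_imp_zero[OF _ _ _ assms])
    show "continuous_on {-1/2..1/2} (\<lambda>x. F x - G x)"
      by (intro continuous_intros contF contG)
    show "F (- x) - G (- x) = F x - G x" for x
      by (simp add: evenF evenG)
    show "((\<lambda>x. (F x - G x) * cos (2 * pi * real j * x)) has_integral 0) {-1/2..1/2}" for j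
    proof -
      have "((\<lambda>x. F x * cos (2 * pi * real j * x) - G x * cos (2 * pi * real j * x)) has_integral
               (exp (- pi * real j ^ 2) - exp (- pi * real j ^ 2))) {-1/2..1/2}"
        by (intro has_integral_diff; subst has_integral_iff)
           (auto simp: coeffF[simplified] coeffG[simplified] intro!: integrable_continuous_interval continuous_intros contF[simplified] contG[simplified])
      thus ?thesis by (simp add: algebra_simps)
    qed
  qed
  thus ?thesis by (simp add: F_def G_def)
qed

section \<open>Theta functions and their addition formulas\<close>

text \<open>The classical theta function with characteristics d and 0 and nome exp (-t), that is tau
  = i t / pi. A general real d lets a single product formula cover all the functions used
  below.\<close>

definition theta :: "real \<Rightarrow> real \<Rightarrow> real \<Rightarrow> complex" where
  "theta t d x = (\<Sum>\<^sub>\<infinity>n::int. exp (- t * (of_int n + d)\<^sup>2) *\<^sub>R cis (2 * pi * (of_int n + d) * x))"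

lemma abs_summable_theta:
  assumes "t > 0"
  shows "(\<lambda>n::int. norm (exp (- t * (of_int n + d)\<^sup>2) *\<^sub>R cis (2 * pi * (of_int n + d) * x))) summable_on UNIV"
  using summable_gaussian_int[OF assms, of d] by simp

lemma infsum_product_abs:
  fixes f :: "'a \<Rightarrow> complex" and g :: "'b \<Rightarrow> complex"
  assumes "(\<lambda>n. norm (f n)) summable_on UNIV" "(\<lambda>n. norm (g n)) summable_on UNIV"
  shows "(\<lambda>x. norm (case x of (m, n) \<Rightarrow> f m * g n)) summable_on UNIV"
    and "infsum f UNIV * infsum g UNIV = (\<Sum>\<^sub>\<infinity>(m, n). f m * g n)"
proof -
  have summ: "(\<lambda>x. norm (case x of (m, n) \<Rightarrow> f m * g n)) summable_on UNIV \<times> UNIV"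
  proof (subst Infinite_Sum.abs_summable_on_Sigma_iff, intro conjI ballI)
    fix m
    show "(\<lambda>y. norm (case (m, y) of (m, n) \<Rightarrow> f m * g n)) summable_on UNIV"
      using assms(2) by (simp add: norm_mult summable_on_cmult_right)
  next
    have "(\<lambda>m. norm (f m) * (\<Sum>\<^sub>\<infinity>n. norm (g n))) summable_on UNIV"
      using assms(1) by (rule summable_on_cmult_left)
    hence "(\<lambda>m. \<Sum>\<^sub>\<infinity>n. norm (f m * g n)) summable_on UNIV"
      by (simp add: norm_mult infsum_cmult_right')
    thus "(\<lambda>m. norm (\<Sum>\<^sub>\<infinity>n. norm (case (m, n) of (m, n) \<Rightarrow> f m * g n))) summable_on UNIV"
      by (simp add: infsum_nonneg)
  qed
  thus "(\<lambda>x. norm (case x of (m, n) \<Rightarrow> f m * g n)) summable_on UNIV"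
    by simp
  have "(\<Sum>\<^sub>\<infinity>(m, n)\<in>UNIV \<times> UNIV. f m * g n) = (\<Sum>\<^sub>\<infinity>m. \<Sum>\<^sub>\<infinity>n. f m * g n)"
    using infsum_Sigma'_banach[OF abs_summable_summable[OF summ]] by simp
  also have "\<dots> = infsum f UNIV * infsum g UNIV"
    by (simp add: infsum_cmult_right' infsum_cmult_left')
  finally show "infsum f UNIV * infsum g UNIV = (\<Sum>\<^sub>\<infinity>(m, n). f m * g n)"
    by simp
qed

text \<open>The double sum over (m, n) is split by the parity p of m - n and reindexed by m = j + k
  + p, n = j - k. A sum of two squares is twice the sum of the squares of the half-sum and the
  half-difference, so each class factors into two theta series of parameter 2 t.\<close>

theorem theta_mult:
  assumes t: "t > 0"
  shows "theta t d (x + y) * theta t e (x - y) =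
           theta (2 * t) ((d + e) / 2) (2 * x) * theta (2 * t) ((d - e) / 2) (2 * y) +
           theta (2 * t) ((1 + d + e) / 2) (2 * x) * theta (2 * t) ((1 + d - e) / 2) (2 * y)"
proof -
  define T where "T t d x n = exp (- t * (of_int n + d)\<^sup>2) *\<^sub>R cis (2 * pi * (of_int n + d) * x)"
    for t d x :: real and n :: int
  have T: "(\<lambda>n. norm (T t d x n)) summable_on UNIV" if "t > 0" for t d x
    unfolding T_def using abs_summable_theta[OF that] .
  define g where "g = (\<lambda>(m, n). T t d (x + y) m * T t e (x - y) n)"
  define P where "P p = {(m, n). (m - n) mod 2 = (p::int)}" for p
  have g: "(\<lambda>x. norm (g x)) summable_on UNIV"
    unfolding g_def using t by (intro infsum_product_abs T)
  have *: "infsum g (P p) = theta (2 * t) ((of_int p + d + e) / 2) (2 * x) *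
                           theta (2 * t) ((of_int p + d - e) / 2) (2 * y)" if p: "p \<in> {0, 1}" for p
  proof -
    have "theta (2 * t) ((of_int p + d + e) / 2) (2 * x) * theta (2 * t) ((of_int p + d - e) / 2) (2 * y) =
          (\<Sum>\<^sub>\<infinity>(j, k). T (2 * t) ((of_int p + d + e) / 2) (2 * x) j * T (2 * t) ((of_int p + d - e) / 2) (2 * y) k)"
      unfolding theta_def T_def[symmetric] by (rule infsum_product_abs(2)) (use t T in auto)
    also have "\<dots> = infsum g (P p)"
    proof (rule infsum_reindex_bij_witness[of _
          "\<lambda>(m, n). ((m + n - p) div 2, (m - n - p) div 2)" "\<lambda>(j, k). (j + k + p, j - k)"])
      fix z :: "int \<times> int"
      obtain j k where z: "z = (j, k)" by force
      show "(case case z of (j, k) \<Rightarrow> (j + k + p, j - k) of (m, n) \<Rightarrow> ((m + n - p) div 2, (m - n - p) div 2)) = z"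
        by (simp add: z)
      show "(case z of (j, k) \<Rightarrow> (j + k + p, j - k)) \<in> P p"
        using p by (auto simp: P_def z; presburger)
      have "- t * (of_int (j + k + p) + d)\<^sup>2 + - t * (of_int (j - k) + e)\<^sup>2 =
            - (2 * t) * (of_int j + (of_int p + d + e) / 2)\<^sup>2 + - (2 * t) * (of_int k + (of_int p + d - e) / 2)\<^sup>2"
        by (simp add: power2_eq_square field_simps)
      moreover have "2 * pi * (of_int (j + k + p) + d) * (x + y) + 2 * pi * (of_int (j - k) + e) * (x - y) =
            2 * pi * (of_int j + (of_int p + d + e) / 2) * (2 * x) +
            2 * pi * (of_int k + (of_int p + d - e) / 2) * (2 * y)"
        by (simp add: field_simps)
      ultimately show "g (case z of (j, k) \<Rightarrow> (j + k + p, j - k)) = (case z of (j, k) \<Rightarrow>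
           T (2 * t) ((of_int p + d + e) / 2) (2 * x) j * T (2 * t) ((of_int p + d - e) / 2) (2 * y) k)"
        unfolding z g_def T_def case_prod_conv mult_scaleR_left mult_scaleR_right scaleR_scaleR
          cis_mult exp_add[symmetric] by (simp only: mult.commute add.commute)
    next
      fix z :: "int \<times> int"
      assume "z \<in> P p"
      moreover obtain m n where z: "z = (m, n)" by force
      ultimately have "(m - n) mod 2 = p" by (simp add: P_def)
      hence "((m + n - p) div 2) * 2 = m + n - p" "((m - n - p) div 2) * 2 = m - n - p"
        by presburger+
      thus "(case case z of (m, n) \<Rightarrow> ((m + n - p) div 2, (m - n - p) div 2) of (j, k) \<Rightarrow> (j + k + p, j - k)) = z"
        by (simp add: z)
    qed auto
    finally show ?thesis by simp
  qed
  have "theta t d (x + y) * theta t e (x - y) = infsum g UNIV"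
    unfolding theta_def T_def[symmetric] g_def by (rule infsum_product_abs(2)) (use t T in auto)
  also have "UNIV = P 0 \<union> P 1"
    by (auto simp: P_def)
  also have "infsum g \<dots> = infsum g (P 0) + infsum g (P 1)"
    by (rule infsum_Un_disjoint)
       (auto simp: P_def intro: summable_on_subset_banach[OF abs_summable_summable[OF g]])
  finally show ?thesis
    by (simp add: *)
qed

lemma theta_shift_char: "theta t (d + 1) x = theta t d x"
  unfolding theta_def
  by (rule infsum_reindex_bij_witness[of _ "\<lambda>n. n - 1" "\<lambda>n. n + 1"]) (auto simp: add_ac)

lemma theta_minus: "theta t d (- x) = cnj (theta t d x)"
  unfolding theta_def by (simp flip: infsum_cnj add: cis_cnj)

lemma theta_minus_char: "theta t (- d) (- x) = theta t d x"
  unfolding theta_def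
  by (rule infsum_reindex_bij_witness[of _ uminus uminus]) (auto simp: power2_eq_square algebra_simps)

lemma theta_shift: "theta t d (x + 1) = cis (2 * pi * d) * theta t d x"
proof -
  have "cis (2 * pi * (of_int n + d) * (x + 1)) = cis (2 * pi * d) * cis (2 * pi * (of_int n + d) * x)" for n
  proof -
    have "cis (2 * pi * (of_int n + d) * (x + 1)) =
          cis (2 * pi * of_int n) * (cis (2 * pi * d) * cis (2 * pi * (of_int n + d) * x))"
      by (simp add: cis_mult algebra_simps)
    thus ?thesis by (simp add: cis_multiple_2pi)
  qed
  thus ?thesis
    unfolding theta_def by (simp flip: infsum_cmult_right')
qed

section \<open>Averaging over torsion points\<close>

lemma sum_cis_multiples:
  fixes n :: int and N :: nat
  assumes "N > 0"
  shows "(\<Sum>k<N. cis (2 * pi * of_int n * (real k / real N))) = (if int N dvd n then of_nat N else 0)"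
proof -
  define w where "w = cis (2 * pi * of_int n / real N)"
  have w: "cis (2 * pi * of_int n * (real k / real N)) = w ^ k" for k
    unfolding w_def Complex.DeMoivre by (simp add: field_simps)
  have wN: "w ^ N = 1"
    unfolding w_def Complex.DeMoivre using assms by (simp add: cis_multiple_2pi)
  show ?thesis
  proof (cases "int N dvd n")
    case True
    then obtain m where "n = int N * m" by blast
    hence "2 * pi * of_int n / real N = 2 * pi * of_int m"
      using assms by simp
    hence "w = 1" unfolding w_def by (simp only: cis_multiple_2pi Ints_of_int)
    thus ?thesis unfolding w using True by simp
  next
    case False
    have "w \<noteq> 1"
    proof
      assume "w = 1"
      hence "cos (2 * pi * of_int n / real N) = 1"
        by (metis cis.sel(1) one_complex.sel(1) w_def)
      then obtain m :: int where "2 * pi * of_int n / real N = of_int m * 2 * pi"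
        by (auto simp: cos_one_2pi_int)
      hence "real_of_int n = of_int (m * int N)"
        using assms by (simp add: field_simps)
      hence "n = m * int N" by (simp only: of_int_eq_iff)
      thus False using False by simp
    qed
    hence "(\<Sum>k<N. w ^ k) = 0"
      by (simp add: geometric_sum wN)
    thus ?thesis unfolding w using False by simp
  qed
qed

lemma has_sum_finite_sum:
  fixes f :: "'a \<Rightarrow> 'b \<Rightarrow> 'c :: {topological_comm_monoid_add}"
  assumes "finite A" "\<And>k. k \<in> A \<Longrightarrow> (f k has_sum S k) X"
  shows "((\<lambda>x. \<Sum>k\<in>A. f k x) has_sum (\<Sum>k\<in>A. S k)) X"
  using assms by (induction A) (auto intro!: has_sum_add has_sum_0)

text \<open>Summing the N-th roots of unity keeps only the frequencies n = N m, and (N m)^2 turns t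
  into t N^2.\<close>

lemma sum_theta_torsion:
  assumes t: "t > 0" and N: "N > 0"
  shows "(\<Sum>k<N. theta t 0 (real k / real N)) = of_nat N * theta (t * real N ^ 2) 0 0"
proof -
  define c where "c n = complex_of_real (exp (- t * (of_int n)\<^sup>2))" for n :: int
  have summand: "((\<lambda>n. c n * cis (2 * pi * of_int n * x)) has_sum theta t 0 x) UNIV" for x
    using has_sum_infsum[OF abs_summable_summable[OF abs_summable_theta[OF t, of 0 x]]]
    by (simp add: c_def theta_def scaleR_conv_of_real)
  have "((\<lambda>n. \<Sum>k<N. c n * cis (2 * pi * of_int n * (real k / real N))) has_sum
           (\<Sum>k<N. theta t 0 (real k / real N))) UNIV"
    by (intro has_sum_finite_sum summand) auto
  hence "(\<Sum>k<N. theta t 0 (real k / real N)) =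
          (\<Sum>\<^sub>\<infinity>n::int. \<Sum>k<N. c n * cis (2 * pi * of_int n * (real k / real N)))"
    by (simp add: infsumI)
  also have "\<dots> = (\<Sum>\<^sub>\<infinity>n. c n * (if int N dvd n then of_nat N else 0))"
    unfolding sum_distrib_left[symmetric] sum_cis_multiples[OF N] ..
  also have "\<dots> = (\<Sum>\<^sub>\<infinity>n\<in>{n. int N dvd n}. c n * of_nat N)"
    by (intro infsum_cong_neutral) auto
  also have "\<dots> = (\<Sum>\<^sub>\<infinity>m::int. c (int N * m) * of_nat N)"
    using N by (intro infsum_reindex_bij_witness[of _ "\<lambda>m. int N * m" "\<lambda>n. n div int N"]) auto
  also have "\<dots> = of_nat N * (\<Sum>\<^sub>\<infinity>m::int. c (int N * m))"
    by (subst infsum_cmult_left') (rule mult.commute)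
  also have "(\<Sum>\<^sub>\<infinity>m::int. c (int N * m)) = theta (t * real N ^ 2) 0 0"
    unfolding theta_def c_def by (simp add: scaleR_conv_of_real power_mult_distrib mult_ac)
  finally show ?thesis .
qed

section \<open>The real theta functions and their addition formulas\<close>

definition theta3 :: "real \<Rightarrow> real \<Rightarrow> real" where
  "theta3 t x = Re (theta t 0 x)"

text \<open>Jacobi's theta_1 at pi x. The shift by 1/2 plays the part of the second characteristic
  and turns the cosines into sines with alternating sign.\<close>

definition theta1 :: "real \<Rightarrow> real \<Rightarrow> real" where
  "theta1 t x = Re (theta t (1 / 2) (x - 1 / 2))"

lemma theta_half_char_even: "theta t (1 / 2) (- x) = theta t (1 / 2) x"
  using theta_minus_char[of t "- (1 / 2)" x] theta_shift_char[of t "- (1 / 2)" x] by simp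

text \<open>Negating x conjugates the value and also preserves it, so the value is real and
  \<open>Re\<close> in the definition loses nothing.\<close>

lemma of_real_theta3: "complex_of_real (theta3 t x) = theta t 0 x"
  using theta_minus[of t 0 x] theta_minus_char[of t 0 x]
  by (simp add: theta3_def complex_eq_iff)

lemma of_real_theta1: "complex_of_real (theta1 t x) = theta t (1 / 2) (x - 1 / 2)"
  using theta_minus[of t "1 / 2" "x - 1 / 2"] theta_half_char_even[of t "x - 1 / 2"]
  by (simp add: theta1_def complex_eq_iff)

lemma theta3_minus: "theta3 t (- x) = theta3 t x"
  using theta_minus_char[of t 0 x] by (simp add: theta3_def)

lemma theta3_reflect: "theta3 t (1 - x) = theta3 t x"
  using theta_shift[of t 0 "- x"] theta3_minus[of t x] by (simp add: theta3_def add.commute)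

lemma theta1_reflect: "theta1 t (1 - x) = theta1 t x"
  using theta_half_char_even[of t "x - 1 / 2"] by (simp add: theta1_def algebra_simps)

text \<open>By \<open>theta_mult\<close> the products at x + y and x - y are bilinear in the values
  of \<open>P\<close> and \<open>R\<close>, which have the doubled parameter; y = 0 gives the
  squares. What remains is an identity of the kind of the two-squares identity.\<close>

theorem
  assumes t: "t > 0"
  shows theta3_add_mult: "theta3 t (x + y) * theta3 t (x - y) * (theta3 t 0)\<^sup>2 =
           (theta3 t x)\<^sup>2 * (theta3 t y)\<^sup>2 + (theta1 t x)\<^sup>2 * (theta1 t y)\<^sup>2" (is ?th3)
    and theta1_add_mult: "theta1 t (x + y) * theta1 t (x - y) * (theta3 t 0)\<^sup>2 =
           (theta1 t x)\<^sup>2 * (theta3 t y)\<^sup>2 - (theta3 t x)\<^sup>2 * (theta1 t y)\<^sup>2" (is ?th1)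
proof -
  define P where "P x = theta (2 * t) 0 (2 * x)" for x
  define R where "R x = theta (2 * t) (1 / 2) (2 * x)" for x
  have th3: "complex_of_real (theta3 t (x + y)) * of_real (theta3 t (x - y)) = P x * P y + R x * R y" for x y
    using theta_mult[OF t, of 0 x y 0] by (simp add: of_real_theta3 P_def R_def)
  \<comment> \<open>A half-period shift of x moves 2 x by 1, which multiplies by cis (2 pi d) with d
    = 0 or 1/2.\<close>
  have "P (x - 1 / 2) = P x" "R (x - 1 / 2) = - R x" for x
    using theta_shift[of "2 * t" 0 "2 * x - 1"] theta_shift[of "2 * t" "1 / 2" "2 * x - 1"]
    by (simp_all add: P_def R_def algebra_simps)
  moreover have "theta (2 * t) 1 z = theta (2 * t) 0 z" for z
    using theta_shift_char[of "2 * t" 0] by simp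
  ultimately have R: "\<And>x. R (x - 1 / 2) = - R x" and P: "\<And>x. P (x - 1 / 2) = P x"
    and P1: "\<And>z. theta (2 * t) 1 z = theta (2 * t) 0 z"
    by blast+
  have th1: "complex_of_real (theta1 t (x + y)) * of_real (theta1 t (x - y)) = P x * R y - R x * P y" for x y
  proof -
    have "x + y - 1 / 2 = (x - 1 / 2) + y" "x - y - 1 / 2 = (x - 1 / 2) - y"
      by simp_all
    hence "complex_of_real (theta1 t (x + y)) * of_real (theta1 t (x - y)) =
        theta t (1 / 2) ((x - 1 / 2) + y) * theta t (1 / 2) ((x - 1 / 2) - y)"
      by (simp only: of_real_theta1)
    also have "\<dots> = theta (2 * t) (1 / 2) (2 * (x - 1 / 2)) * theta (2 * t) 0 (2 * y) +
        theta (2 * t) 1 (2 * (x - 1 / 2)) * theta (2 * t) (1 / 2) (2 * y)"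
      unfolding theta_mult[OF t] by simp
    also have "\<dots> = R (x - 1 / 2) * P y + P (x - 1 / 2) * R y"
      by (simp only: P1 P_def R_def)
    finally show ?thesis
      by (simp add: R P)
  qed
  have sq3: "(complex_of_real (theta3 t x))\<^sup>2 = P x * P 0 + R x * R 0"
    and sq1: "(complex_of_real (theta1 t x))\<^sup>2 = P x * R 0 - R x * P 0" for x
    using th3[of x 0] th1[of x 0] by (simp_all add: power2_eq_square)
  have "complex_of_real (theta3 t (x + y) * theta3 t (x - y) * (theta3 t 0)\<^sup>2) =
        of_real ((theta3 t x)\<^sup>2 * (theta3 t y)\<^sup>2 + (theta1 t x)\<^sup>2 * (theta1 t y)\<^sup>2)"
    unfolding of_real_mult of_real_add of_real_power th3 sq3 sq1 by algebra
  thus ?th3 by (simp only: of_real_eq_iff)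
  have "complex_of_real (theta1 t (x + y) * theta1 t (x - y) * (theta3 t 0)\<^sup>2) =
        of_real ((theta1 t x)\<^sup>2 * (theta3 t y)\<^sup>2 - (theta3 t x)\<^sup>2 * (theta1 t y)\<^sup>2)"
    unfolding of_real_mult of_real_diff of_real_power th1 sq3 sq1 by algebra
  thus ?th1 by (simp only: of_real_eq_iff)
qed

section \<open>Self-duality at the special nome and positivity\<close>

lemma theta3_pi_self_dual:
  assumes "x \<in> {-1/2..1/2}"
  shows "theta3 pi x = (\<Sum>\<^sub>\<infinity>n::int. exp (- pi * (of_int n + x)\<^sup>2))"
proof -
  have "theta3 pi x = (\<Sum>\<^sub>\<infinity>n::int. Re (exp (- pi * (of_int n + 0)\<^sup>2) *\<^sub>R cis (2 * pi * (of_int n + 0) * x)))"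
    unfolding theta3_def theta_def
    by (rule infsum_Re[symmetric]) (rule abs_summable_summable[OF abs_summable_theta], simp)
  thus ?thesis
    using gaussian_poisson_summation[OF assms] by simp
qed

text \<open>The cosine series has no evident sign, but its dual is a sum of positive
  Gaussians.\<close>

lemma theta3_pi_pos:
  assumes "x \<in> {-1/2..1/2}"
  shows "theta3 pi x > 0"
  unfolding theta3_pi_self_dual[OF assms]
proof -
  have "0 < exp (- pi * (of_int 0 + x)\<^sup>2)" by simp
  also have "\<dots> = (\<Sum>\<^sub>\<infinity>n\<in>{0::int}. exp (- pi * (of_int n + x)\<^sup>2))" by simp
  also have "\<dots> \<le> (\<Sum>\<^sub>\<infinity>n::int. exp (- pi * (of_int n + x)\<^sup>2))"
    by (rule infsum_mono_neutral) (use summable_gaussian_int[of pi x] in auto)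
  finally show "(\<Sum>\<^sub>\<infinity>n::int. exp (- pi * (of_int n + x)\<^sup>2)) > 0" .
qed

text \<open>At x = 1/2 every phase of \<open>theta1\<close> is 1, which leaves the Gaussian sum over
  the half-integers, the dual series of \<open>theta3\<close> at 1/2.\<close>

lemma theta1_pi_half: "theta1 pi (1 / 2) = theta3 pi (1 / 2)"
proof -
  have "theta1 pi (1 / 2) = (\<Sum>\<^sub>\<infinity>n::int. Re (exp (- pi * (of_int n + 1 / 2)\<^sup>2) *\<^sub>R cis (2 * pi * (of_int n + 1 / 2) * (1 / 2 - 1 / 2))))"
    unfolding theta1_def theta_def
    by (rule infsum_Re[symmetric]) (rule abs_summable_summable[OF abs_summable_theta], simp)
  thus ?thesis
    using theta3_pi_self_dual[of "1 / 2"] by simp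
qed

lemma abs_sin_nat_mult_le:
  fixes y :: real
  shows "\<bar>sin (real n * y)\<bar> \<le> real n * \<bar>sin y\<bar>"
proof (induction n)
  case (Suc n)
  have "\<bar>sin (real (Suc n) * y)\<bar> = \<bar>sin (real n * y) * cos y + cos (real n * y) * sin y\<bar>"
    by (simp add: algebra_simps sin_add)
  also have "\<dots> \<le> \<bar>sin (real n * y)\<bar> * \<bar>cos y\<bar> + \<bar>cos (real n * y)\<bar> * \<bar>sin y\<bar>"
    by (metis abs_mult abs_triangle_ineq)
  also have "\<dots> \<le> \<bar>sin (real n * y)\<bar> * 1 + 1 * \<bar>sin y\<bar>"
    by (intro add_mono mult_left_mono mult_right_mono) auto
  finally show ?case using Suc.IH by (simp add: algebra_simps)
qed simp

text \<open>Pairing n with -n - 1 negates n + 1/2 and folds the sum into the classical sine series,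
  from whose leading term positivity is read off.\<close>

lemma theta1_conv_suminf:
  fixes t x :: real
  assumes t: "t > 0"
  defines "f \<equiv> \<lambda>n::nat. (-1) ^ n * exp (- t * (real n + 1 / 2)\<^sup>2) * sin (real (2 * n + 1) * (pi * x))"
  shows "summable (\<lambda>n. \<bar>f n\<bar>)" and "theta1 t x = 2 * (\<Sum>n. f n)"
proof -
  define g where "g n = Re (exp (- t * (of_int n + 1 / 2)\<^sup>2) *\<^sub>R cis (2 * pi * (of_int n + 1 / 2) * (x - 1 / 2)))"
    for n :: int
  have g_nat: "g (int n) = f n" for n
  proof -
    have "2 * pi * (real n + 1 / 2) * (x - 1 / 2) = real (2 * n + 1) * (pi * x) - pi / 2 - of_int (int n) * pi"
      by (simp add: field_simps)
    hence "cos (2 * pi * (real n + 1 / 2) * (x - 1 / 2)) =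
          cos (real (2 * n + 1) * (pi * x) - pi / 2 - of_int (int n) * pi)"
      by (simp only:)
    also have "\<dots> = (-1) ^ n * sin (real (2 * n + 1) * (pi * x))"
      unfolding cos_diff[of _ "of_int (int n) * pi"] by (simp add: cos_diff)
    finally show ?thesis by (simp add: g_def f_def)
  qed
  have g_neg: "g (- int n - 1) = f n" for n
  proof -
    have neg: "of_int (- int n - 1) + 1 / 2 = - (real n + 1 / 2)"
      by simp
    have "g (- int n - 1) = g (int n)"
      unfolding g_def neg power2_minus mult_minus_left mult_minus_right by (simp flip: cis_cnj)
    thus ?thesis by (simp add: g_nat)
  qed
  have summ: "(\<lambda>n. exp (- t * (of_int n + 1 / 2)\<^sup>2)) summable_on (UNIV :: int set)"
    using summable_gaussian_int[OF t] .
  have g_abs: "(\<lambda>n. norm (g n)) summable_on UNIV"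
  proof (rule summable_on_comparison_test[OF summ])
    fix n :: int
    show "norm (g n) \<le> exp (- t * (of_int n + 1 / 2)\<^sup>2)"
      unfolding g_def by (simp add: abs_mult mult_left_le)
  qed auto
  have "(\<lambda>n. norm (f n)) summable_on UNIV"
    using summable_on_subset_banach[OF g_abs, of "{0..}"]
    by (subst summable_on_reindex_bij_witness[where j = int and i = nat and T = "{0..}" and h = "\<lambda>n. norm (g n)"])
       (auto simp: g_nat)
  thus abs: "summable (\<lambda>n. \<bar>f n\<bar>)"
    by (simp add: summable_on_UNIV_nonneg_real_iff)
  hence f: "infsum f UNIV = (\<Sum>n. f n)"
    using norm_summable_imp_has_sum[of f] by (simp add: infsumI summable_sums summable_rabs_cancel)
  have "theta1 t x = infsum g UNIV"
    unfolding theta1_def theta_def g_def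
    by (rule infsum_Re[symmetric]) (rule abs_summable_summable[OF abs_summable_theta[OF t]])
  also have "UNIV = {0..} \<union> {..<(0::int)}"
    by auto
  also have "infsum g \<dots> = infsum g {0..} + infsum g {..<0}"
    by (rule infsum_Un_disjoint)
       (auto intro!: summable_on_subset_banach[OF abs_summable_summable[OF g_abs]])
  also have "infsum g {0..} = infsum f UNIV"
    by (rule infsum_reindex_bij_witness[of _ int nat]) (auto simp flip: g_nat)
  also have "infsum g {..<0} = infsum f UNIV"
    by (rule infsum_reindex_bij_witness[of _ "\<lambda>n. - int n - 1" "\<lambda>n. nat (- n - 1)"]) (auto simp flip: g_neg)
  finally show "theta1 t x = 2 * (\<Sum>n. f n)"
    by (simp add: f)
qed

text \<open>The first term dominates. Estimating |sin ((2 n + 1) pi x)| by (2 n + 1) sin (pi x)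
  keeps the comparison uniform near the endpoints. With 2 n + 1 <= 3^n and (n + 1/2)^2 >= 1/4 + 2 n
  for n >= 1, the tail is at most a geometric series of ratio \<open>r\<close> < 1/2, so r / (1 - r)
  < 1.\<close>

lemma theta1_pos:
  assumes t: "t \<ge> 3" and x: "0 < x" "x < 1"
  shows "theta1 t x > 0"
proof -
  define f where "f n = (-1) ^ n * exp (- t * (real n + 1 / 2)\<^sup>2) * sin (real (2 * n + 1) * (pi * x))" for n
  have abs: "summable (\<lambda>n. \<bar>f n\<bar>)" and eq: "theta1 t x = 2 * (\<Sum>n. f n)"
    using theta1_conv_suminf[of t x] t unfolding f_def by auto
  define C where "C = exp (- t / 4) * sin (pi * x)"
  have sin: "sin (pi * x) > 0"
    using x by (intro sin_gt_zero) auto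
  hence C: "C > 0" by (simp add: C_def)
  define r where "r = 3 * exp (- 2 * t)"
  have "exp (2 * t) \<ge> 1 + 2 * t"
    by (rule exp_ge_add_one_self)
  hence "exp (2 * t) > 6" using t by linarith
  hence r: "0 < r" "r < 1 / 2"
    by (auto simp: r_def exp_minus field_simps)
  have bound: "\<bar>f (Suc n)\<bar> \<le> C * r * r ^ n" for n
  proof -
    have pow: "real (2 * m + 1) \<le> 3 ^ m" for m
      by (induction m) auto
    have "\<bar>f (Suc n)\<bar> = exp (- t * (real (Suc n) + 1 / 2)\<^sup>2) * \<bar>sin (real (2 * Suc n + 1) * (pi * x))\<bar>"
      by (simp add: f_def abs_mult)
    also have "\<dots> \<le> exp (- t / 4 - 2 * t * real (Suc n)) * (real (2 * Suc n + 1) * sin (pi * x))"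
    proof (intro mult_mono)
      have "t / 4 + 2 * t * real (Suc n) \<le> t * (real (Suc n) + 1 / 2)\<^sup>2"
      proof -
        have "(real (Suc n) + 1 / 2)\<^sup>2 - (1 / 4 + 2 * real (Suc n)) = real n * real (Suc n)"
          by (simp add: power2_eq_square field_simps)
        moreover have "\<dots> \<ge> 0" by simp
        ultimately have "t * (1 / 4 + 2 * real (Suc n)) \<le> t * (real (Suc n) + 1 / 2)\<^sup>2"
          using t by (intro mult_left_mono) linarith+
        thus ?thesis by (simp add: algebra_simps)
      qed
      thus "exp (- t * (real (Suc n) + 1 / 2)\<^sup>2) \<le> exp (- t / 4 - 2 * t * real (Suc n))"
        by simp
    qed (use abs_sin_nat_mult_le[of "2 * Suc n + 1" "pi * x"] sin in auto)
    also have "\<dots> \<le> exp (- t / 4 - 2 * t * real (Suc n)) * (3 ^ Suc n * sin (pi * x))"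
      using sin by (intro mult_left_mono mult_right_mono pow) auto
    also have "exp (- t / 4 - 2 * t * real (Suc n)) = exp (- t / 4) * exp (- 2 * t) ^ Suc n"
      unfolding exp_of_nat_mult[symmetric] exp_add[symmetric] by (simp add: algebra_simps)
    finally show ?thesis
      by (simp add: C_def r_def power_mult_distrib mult_ac)
  qed
  have sumr: "(\<lambda>n. C * r * r ^ n) sums (C * r * (1 / (1 - r)))"
    using r by (intro sums_mult geometric_sums) auto
  have "\<bar>\<Sum>n. f (Suc n)\<bar> \<le> (\<Sum>n. \<bar>f (Suc n)\<bar>)"
    using abs by (intro summable_rabs) (simp add: summable_Suc_iff[of "\<lambda>n. \<bar>f n\<bar>"])
  also have "\<dots> \<le> C * r * (1 / (1 - r))"
    unfolding sums_unique[OF sumr]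
    using bound abs sums_summable[OF sumr] by (intro suminf_le) (auto simp: summable_Suc_iff[of "\<lambda>n. \<bar>f n\<bar>"])
  also have "\<dots> < C"
    using C r by (simp add: field_simps)
  also have "C = f 0"
    by (simp add: f_def C_def power2_eq_square)
  also have "(\<Sum>n. f (Suc n)) = (\<Sum>n. f n) - f 0"
    using suminf_split_head[of f] abs summable_rabs_cancel by blast
  finally show ?thesis
    unfolding eq by linarith
qed

section \<open>Values at the ninths of the period\<close>

lemma theta3_pi_pos_unit:
  assumes "x \<in> {0..1}"
  shows "theta3 pi x > 0"
proof (cases "x \<le> 1 / 2")
  case True
  thus ?thesis using assms by (intro theta3_pi_pos) auto
next
  case False
  hence "theta3 pi (1 - x) > 0" using assms by (intro theta3_pi_pos) auto
  thus ?thesis by (simp add: theta3_reflect)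
qed

definition theta_ratio :: "real \<Rightarrow> real" where
  "theta_ratio x = theta1 pi x / theta3 pi x"

definition theta3_norm :: "real \<Rightarrow> real" where
  "theta3_norm x = theta3 pi x / theta3 pi 0"

lemma theta_ratio_pos: "0 < x \<Longrightarrow> x < 1 \<Longrightarrow> theta_ratio x > 0"
  unfolding theta_ratio_def using pi_gt3 by (intro divide_pos_pos theta1_pos theta3_pi_pos_unit) auto

lemma theta3_norm_pos: "x \<in> {0..1} \<Longrightarrow> theta3_norm x > 0"
  unfolding theta3_norm_def by (intro divide_pos_pos theta3_pi_pos_unit) auto

lemma theta_ratio_reflect: "theta_ratio (1 - x) = theta_ratio x"
  by (simp add: theta_ratio_def theta1_reflect theta3_reflect)

lemma theta3_norm_reflect: "theta3_norm (1 - x) = theta3_norm x"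
  by (simp add: theta3_norm_def theta3_reflect)

lemma theta_ratio_half: "theta_ratio (1 / 2) = 1"
  using theta3_pi_pos[of "1 / 2"] by (simp add: theta_ratio_def theta1_pi_half)

lemma theta3_norm_add_mult:
  assumes "x \<in> {0..1}" "y \<in> {0..1}"
  shows "theta3_norm (x + y) * theta3_norm (x - y) =
           (theta3_norm x)\<^sup>2 * (theta3_norm y)\<^sup>2 * (1 + (theta_ratio x)\<^sup>2 * (theta_ratio y)\<^sup>2)"
proof -
  define c where "c = theta3 pi 0"
  have pos: "theta3 pi x > 0" "theta3 pi y > 0" "c > 0"
    using assms by (auto intro!: theta3_pi_pos_unit simp: c_def)
  have th3: "theta3 pi z = theta3_norm z * c" for z
    using pos by (simp add: theta3_norm_def c_def)
  have norm0: "theta3_norm 0 = 1"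
    using pos by (simp add: theta3_norm_def c_def)
  have th1: "theta1 pi x = theta_ratio x * theta3 pi x" "theta1 pi y = theta_ratio y * theta3 pi y"
    using pos by (simp_all add: theta_ratio_def)
  have "c ^ 4 * (theta3_norm (x + y) * theta3_norm (x - y)) =
        c ^ 4 * ((theta3_norm x)\<^sup>2 * (theta3_norm y)\<^sup>2 * (1 + (theta_ratio x)\<^sup>2 * (theta_ratio y)\<^sup>2))"
    using theta3_add_mult[of pi x y, OF pi_gt_zero] norm0 unfolding th1 th3 by algebra
  thus ?thesis using pos by simp
qed

text \<open>The quotient of the two addition formulas, of the same type as the formula for sn (x +
  y) sn (x - y). The ranges keep all denominators positive.\<close>

lemma theta_ratio_add_mult:
  assumes "x \<in> {0..1}" "y \<in> {0..1}" "x + y \<in> {0..1}" "x - y \<in> {0..1}"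
  shows "theta_ratio (x + y) * theta_ratio (x - y) * (1 + (theta_ratio x)\<^sup>2 * (theta_ratio y)\<^sup>2) =
           (theta_ratio x)\<^sup>2 - (theta_ratio y)\<^sup>2"
proof -
  have pos: "theta3 pi x > 0" "theta3 pi y > 0" "theta3 pi (x + y) > 0" "theta3 pi (x - y) > 0" "theta3 pi 0 > 0"
    using assms by (auto intro!: theta3_pi_pos_unit)
  define K where "K = (theta3 pi x)\<^sup>2 * (theta3 pi y)\<^sup>2"
  define L where "L = theta3 pi (x + y) * theta3 pi (x - y) * (theta3 pi 0)\<^sup>2"
  have KL: "K > 0" "L > 0"
    using pos by (auto simp: K_def L_def)
  have th1: "theta1 pi x = theta_ratio x * theta3 pi x" "theta1 pi y = theta_ratio y * theta3 pi y"
      "theta1 pi (x + y) = theta_ratio (x + y) * theta3 pi (x + y)"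
      "theta1 pi (x - y) = theta_ratio (x - y) * theta3 pi (x - y)"
    using pos by (simp_all add: theta_ratio_def)
  have "L = K * (1 + (theta_ratio x)\<^sup>2 * (theta_ratio y)\<^sup>2)"
    using theta3_add_mult[of pi x y] unfolding th1 K_def L_def by (simp add: algebra_simps)
  moreover have "theta_ratio (x + y) * theta_ratio (x - y) * L = K * ((theta_ratio x)\<^sup>2 - (theta_ratio y)\<^sup>2)"
    using theta1_add_mult[of pi x y] unfolding th1 K_def L_def by (simp add: algebra_simps)
  ultimately have "K * (theta_ratio (x + y) * theta_ratio (x - y) * (1 + (theta_ratio x)\<^sup>2 * (theta_ratio y)\<^sup>2)) =
      K * ((theta_ratio x)\<^sup>2 - (theta_ratio y)\<^sup>2)"
    by (simp add: mult_ac)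
  thus ?thesis using KL by simp
qed

text \<open>The pairs (1/2, 1/3) and (1/3, 1/6), with the value 1 at 1/2, give two equations for
  \<open>T\<close> and \<open>v\<close>. Eliminating \<open>T\<close> and removing the positive
  factor v + 1 leaves a palindromic quartic, which in terms of \<open>T\<close> reads (T^2 + 3)^2 =
  12.\<close>

lemma theta_ratio_third: "theta_ratio (1 / 3) ^ 4 = 2 * sqrt 3 - 3"
proof -
  define T v where "T = (theta_ratio (1 / 3))\<^sup>2" and "v = theta_ratio (1 / 6)"
  have v: "v > 0" unfolding v_def by (rule theta_ratio_pos) auto
  have "theta_ratio (5 / 6) = v"
    using theta_ratio_reflect[of "1 / 6"] by (simp add: v_def)
  hence T: "v\<^sup>2 * (1 + T) = 1 - T"
    using theta_ratio_add_mult[of "1 / 2" "1 / 3"]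
    by (simp add: theta_ratio_half T_def v_def power2_eq_square)
  have "v * (1 + T * v\<^sup>2) = T - v\<^sup>2"
    using theta_ratio_add_mult[of "1 / 3" "1 / 6"]
    by (simp add: theta_ratio_half T_def v_def)
  hence "(v + 1) * (v ^ 4 - 2 * v ^ 3 - 2 * v + 1) = 0"
    using T by algebra
  hence "v ^ 4 - 2 * v ^ 3 - 2 * v + 1 = 0"
    using v by simp
  \<comment> \<open>The factor clears the denominators of T = (1 - v^2) / (1 + v^2).\<close>
  hence "(1 + v\<^sup>2) ^ 4 * ((T\<^sup>2 + 3)\<^sup>2 - 12) = 0"
    using T by algebra
  moreover have "1 + v\<^sup>2 > 0"
    by (simp add: add_pos_nonneg)
  ultimately have "(T\<^sup>2 + 3)\<^sup>2 = 12"
    by simp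
  hence "T\<^sup>2 + 3 = sqrt 12"
    by (intro real_sqrt_unique[symmetric]) auto
  also have "sqrt 12 = 2 * sqrt 3"
    using real_sqrt_mult[of 4 3] by simp
  finally show ?thesis
    by (simp add: T_def flip: power_mult)
qed

text \<open>
  Here \<open>h\<close>, \<open>x\<close>, \<open>y\<close>, \<open>z\<close> stand for the values of \<^const>\<open>theta_ratio\<close> at \<open>3/9\<close>, \<open>1/9\<close>, \<open>2/9\<close> and
  minus its value at \<open>4/9\<close>. With this sign the last three are the values at \<open>1/9\<close>, \<open>7/9\<close>, \<open>13/9\<close>, which
  differ by a third of the period 2, so that their elementary symmetric functions are simple.
\<close>

lemma ninth_ratios_symmetric:
  fixes h x y z :: real
  assumes b1: "x\<^sup>2 - h\<^sup>2 = y * z * (1 + x\<^sup>2 * h\<^sup>2)"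
    and b2: "y\<^sup>2 - h\<^sup>2 = z * x * (1 + y\<^sup>2 * h\<^sup>2)"
    and a1: "h * x * (1 + x\<^sup>2 * y\<^sup>2) = y\<^sup>2 - x\<^sup>2"
    and a2: "h * y * (1 + y\<^sup>2 * z\<^sup>2) = z\<^sup>2 - y\<^sup>2"
    and a3: "h * z * (1 + z\<^sup>2 * x\<^sup>2) = x\<^sup>2 - z\<^sup>2"
    and neq: "x \<noteq> y" "h \<noteq> 0"
  defines "T \<equiv> h\<^sup>2"
  defines "e \<equiv> x * y * z"
  defines "E \<equiv> T * e\<^sup>2"
  shows "x + y + z = T * e" and "x * y + y * z + z * x = - T"
    and "E ^ 3 - 3 * E\<^sup>2 + (6 * T\<^sup>2 + 9) * E - T ^ 4 = 0"
proof -
  \<comment> \<open>This is the difference of \<open>b1\<close> and \<open>b2\<close>, in which x -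
    y splits off.\<close>
  have "(x - y) * (x + y + z - T * e) = 0"
    unfolding T_def e_def using b1 b2 by algebra
  thus e1: "x + y + z = T * e" using neq by simp
  show e2: "x * y + y * z + z * x = - T"
    using e1 b1 unfolding T_def e_def by algebra
  \<comment> \<open>\<open>a1\<close> to \<open>a3\<close> are only cyclically symmetric. In their
    sum the right sides telescope, which fixes \<open>Q\<close> and then \<open>C\<close>. Since C +
    C' and C C' are fully symmetric, inserting \<open>C\<close> leaves an equation in
    \<open>E\<close> and \<open>T\<close>.\<close>
  define C where "C = x\<^sup>2 * y + y\<^sup>2 * z + z\<^sup>2 * x"
  define C' where "C' = x * y\<^sup>2 + y * z\<^sup>2 + z * x\<^sup>2"
  define Q where "Q = x ^ 3 * y\<^sup>2 + y ^ 3 * z\<^sup>2 + z ^ 3 * x\<^sup>2"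
  have "h * (x + y + z + Q) = 0"
    using a1 a2 a3 unfolding Q_def by algebra
  hence Q: "Q = - (T * e)"
    using neq e1 by simp
  have "C * (x * y + y * z + z * x) = Q + e * ((x + y + z)\<^sup>2 - (x * y + y * z + z * x))"
    unfolding C_def Q_def e_def by algebra
  hence "T * (C + T * e ^ 3) = 0"
    unfolding e1 e2 Q by algebra
  hence C: "C = - (T * e ^ 3)"
    using neq by (simp add: T_def add_eq_0_iff2)
  have sum: "C + C' = - T * (T * e) - 3 * e"
  proof -
    have "C + C' = (x + y + z) * (x * y + y * z + z * x) - 3 * e"
      unfolding C_def C'_def e_def by algebra
    thus ?thesis by (simp add: e1 e2)
  qed
  have prod: "C * C' = (T * e) ^ 3 * e - T ^ 3 + 6 * T * (T * e) * e + 9 * e\<^sup>2"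
  proof -
    have "C * C' = (x + y + z) ^ 3 * e + (x * y + y * z + z * x) ^ 3 -
            6 * (x + y + z) * (x * y + y * z + z * x) * e + 9 * e\<^sup>2"
      unfolding C_def C'_def e_def by algebra
    thus ?thesis by (simp add: e1 e2)
  qed
  show "E ^ 3 - 3 * E\<^sup>2 + (6 * T\<^sup>2 + 9) * E - T ^ 4 = 0"
    using sum prod C unfolding E_def by algebra
qed

text \<open>The cubic has derivative 3 (E - 1)^2 + 6 w + 6 > 0, hence a single real root, and the
  equation for \<open>B\<close> makes (B - 1)^2 a root. The shift by 1 in \<open>a\<close> and
  \<open>b\<close> centres the cubic at its inflection point.\<close>

lemma monotone_cubic_root:
  fixes B E w :: real
  assumes w: "w = B ^ 3 - 1" "w > -1" and B: "B ^ 6 + 4 * B ^ 3 = 8"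
    and E: "E ^ 3 - 3 * E\<^sup>2 + (6 * w + 9) * E - w\<^sup>2 = 0"
  shows "E = (B - 1)\<^sup>2"
proof -
  define a b where "a = E - 1" and "b = (B - 1)\<^sup>2 - 1"
  have "(E - (B - 1)\<^sup>2) * (a\<^sup>2 + a * b + b\<^sup>2 + 6 * w + 6) = 0"
    using E B w(1) unfolding a_def b_def by algebra
  moreover have "a\<^sup>2 + a * b + b\<^sup>2 \<ge> 0"
  proof -
    have "a\<^sup>2 + a * b + b\<^sup>2 = (a + b / 2)\<^sup>2 + 3 / 4 * b\<^sup>2"
      by (simp add: power2_eq_square field_simps)
    thus ?thesis by simp
  qed
  ultimately show ?thesis using w(2) by auto
qed

text \<open>By Vieta both triples are the roots of one monic cubic; the ordering excludes a
  permutation.\<close>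

lemma sorted_cubic_roots_unique:
  fixes a b c a' b' c' :: real
  assumes "a < b" "b < c" "a' < b'" "b' < c'"
    and "a + b + c = a' + b' + c'" "a * b + b * c + c * a = a' * b' + b' * c' + c' * a'"
    and "a * b * c = a' * b' * c'"
  shows "a = a' \<and> b = b' \<and> c = c'"
proof -
  have "(x - a) * (x - b) * (x - c) = (x - a') * (x - b') * (x - c')" for x
    using assms(5-7) by algebra
  from this[of a'] this[of b'] this[of c'] have "a' = a \<or> a' = b \<or> a' = c"
    "b' = a \<or> b' = b \<or> b' = c" "c' = a \<or> c' = b \<or> c' = c" by auto
  thus ?thesis using assms(1-4) by auto
qed

text \<open>The values f k turn out to be u_k / 2. Sorted order and elementary symmetric functions
  determine the \<open>X\<^sub>i\<close>, these fix the ratios of the f k, and the product of f 1, f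
  2, f 4 fixes the scale.\<close>

theorem theta3_norm_ninths:
  fixes A B :: real and f :: "nat \<Rightarrow> real"
  assumes AB: "A * B = 2" "A ^ 3 = 2 * (sqrt 3 + 1)" "B ^ 3 = 2 * (sqrt 3 - 1)"
  defines "f \<equiv> \<lambda>k. theta3_norm (real k / 9)"
  defines "X\<^sub>1 \<equiv> f 2 * f 4 / (f 1)\<^sup>2"
  defines "X\<^sub>2 \<equiv> f 1 * f 4 / (f 2)\<^sup>2"
  defines "X\<^sub>3 \<equiv> f 1 * f 2 / (f 4)\<^sup>2"
  shows "f 3 * B = 1"
    and "X\<^sub>1 < X\<^sub>2" and "X\<^sub>2 < X\<^sub>3"
    and "X\<^sub>1 * X\<^sub>2 * X\<^sub>3 = 1"
    and "X\<^sub>1 + X\<^sub>2 + X\<^sub>3 = B ^ 3 - 2 * B\<^sup>2 + 3 * B - 1 + A"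
    and "X\<^sub>1 * X\<^sub>2 + X\<^sub>2 * X\<^sub>3 + X\<^sub>3 * X\<^sub>1 = B\<^sup>2 + A"
    and "(f 1 * f 2 * f 4) ^ 3 * (64 * (B - 1)) = B ^ 3 * (A + 1)"
proof -
  define s where "s k = theta_ratio (real k / 9)" for k :: nat
  have s_pos: "s k > 0" if "0 < k" "k < 9" for k
    unfolding s_def using that by (intro theta_ratio_pos) auto
  have f_pos: "f k > 0" if "k \<le> 9" for k
    unfolding f_def using that by (intro theta3_norm_pos) auto
  have s_add: "s (m + n) * s (m - n) * (1 + (s m)\<^sup>2 * (s n)\<^sup>2) = (s m)\<^sup>2 - (s n)\<^sup>2"
    if "n \<le> m" "m + n \<le> 9" for m n
    using theta_ratio_add_mult[of "real m / 9" "real n / 9"] that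
    by (simp add: s_def of_nat_diff flip: add_divide_distrib diff_divide_distrib)
  have f_add: "f (m + n) * f (m - n) = (f m)\<^sup>2 * (f n)\<^sup>2 * (1 + (s m)\<^sup>2 * (s n)\<^sup>2)"
    if "n \<le> m" "m \<le> 9" for m n
    using theta3_norm_add_mult[of "real m / 9" "real n / 9"] that
    by (simp add: s_def f_def of_nat_diff flip: add_divide_distrib diff_divide_distrib)
  have s_refl: "s 5 = s 4" "s 6 = s 3" "s 7 = s 2" "s 8 = s 1"
    using theta_ratio_reflect[of "4 / 9"] theta_ratio_reflect[of "3 / 9"]
      theta_ratio_reflect[of "2 / 9"] theta_ratio_reflect[of "1 / 9"] by (simp_all add: s_def)
  have f_refl: "f 5 = f 4" "f 6 = f 3" "f 7 = f 2" "f 8 = f 1"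
    using theta3_norm_reflect[of "4 / 9"] theta3_norm_reflect[of "3 / 9"]
      theta3_norm_reflect[of "2 / 9"] theta3_norm_reflect[of "1 / 9"] by (simp_all add: f_def)
  have f0: "f 0 = 1"
    using theta3_pi_pos[of 0] by (simp add: f_def theta3_norm_def)

  define x y z h where "x = s 1" and "y = s 2" and "z = - s 4" and "h = s 3"
  have pos: "x > 0" "y > 0" "z < 0" "h > 0"
    using s_pos by (simp_all add: x_def y_def z_def h_def)
  define T e E w where "T = h\<^sup>2" and "e = x * y * z" and "E = T * e\<^sup>2" and "w = T\<^sup>2"
  have T: "T > 0" and "e < 0"
    using pos by (auto simp: T_def e_def mult_pos_neg)

  \<comment> \<open>In \<open>s_add\<close> the premise \<open>n \<le> m\<close> comes first, so
    \<open>of 1 3\<close> means n = 1, m = 3 and the natural-number difference is exact.\<close>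
  have b1: "x\<^sup>2 - h\<^sup>2 = y * z * (1 + x\<^sup>2 * h\<^sup>2)"
    using s_add[of 1 3] by (simp add: x_def y_def z_def h_def algebra_simps)
  have b2: "y\<^sup>2 - h\<^sup>2 = z * x * (1 + y\<^sup>2 * h\<^sup>2)"
    using s_add[of 2 3] s_refl by (simp add: x_def y_def z_def h_def algebra_simps)
  have a1: "h * x * (1 + x\<^sup>2 * y\<^sup>2) = y\<^sup>2 - x\<^sup>2"
    using s_add[of 1 2] by (simp add: x_def y_def z_def h_def algebra_simps flip: numeral_3_eq_3)
  have a2: "h * y * (1 + y\<^sup>2 * z\<^sup>2) = z\<^sup>2 - y\<^sup>2"
    using s_add[of 2 4] s_refl by (simp add: x_def y_def z_def h_def algebra_simps)
  have a3: "h * z * (1 + z\<^sup>2 * x\<^sup>2) = x\<^sup>2 - z\<^sup>2"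
    using s_add[of 1 4] s_refl by (simp add: x_def y_def z_def h_def algebra_simps)
  have "h * x * (1 + x\<^sup>2 * y\<^sup>2) > 0" "h * y * (1 + y\<^sup>2 * z\<^sup>2) > 0"
    using pos by (auto intro!: mult_pos_pos add_pos_nonneg)
  hence less: "x\<^sup>2 < y\<^sup>2" "y\<^sup>2 < z\<^sup>2"
    using a1 a2 by simp_all
  hence neq: "x \<noteq> y" "h \<noteq> 0" using pos by auto
  note sym = ninth_ratios_symmetric[OF b1 b2 a1 a2 a3 neq, folded T_def, folded e_def, folded E_def]

  have "w = 2 * sqrt 3 - 3"
    using theta_ratio_third by (simp add: w_def T_def h_def s_def flip: power_mult)
  hence w: "w = B ^ 3 - 1"
    using AB(3) by simp
  have "B > 0"
    using AB(3) zero_less_power_eq[of B 3] by simp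
  have B6: "B ^ 6 + 4 * B ^ 3 = 8"
  proof -
    have "A ^ 3 * B ^ 3 = 8"
      using AB(1) by (simp flip: power_mult_distrib)
    moreover have "A ^ 3 = 4 + B ^ 3"
      using AB by simp
    ultimately show ?thesis
      by (simp add: distrib_right flip: power_add)
  qed
  have E: "E = (B - 1)\<^sup>2"
  proof (rule monotone_cubic_root[OF w _ B6])
    show "w > -1" using zero_le_power2[of T] unfolding w_def by linarith
    show "E ^ 3 - 3 * E\<^sup>2 + (6 * w + 9) * E - w\<^sup>2 = 0"
      using sym(3) by (simp add: w_def flip: power_mult)
  qed

  \<comment> \<open>Duplication at 3/9, where reflection returns f 6 to f 3.\<close>
  have "f 3 = f 3 * (f 3 ^ 3 * (1 + w))"
    using f_add[of 3 3] f_refl f0 by (simp add: w_def T_def h_def power2_eq_square power3_eq_cube power4_eq_xxxx mult_ac)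
  hence "f 3 ^ 3 * (1 + w) = 1"
    using f_pos[of 3] by simp
  hence "(f 3 * B) ^ 3 = 1 ^ 3"
    by (simp add: w power_mult_distrib)
  thus f3: "f 3 * B = 1"
    using \<open>B > 0\<close> f_pos[of 3] by (subst (asm) power_eq_iff_eq_base) auto

  \<comment> \<open>Up to reflection, adding and subtracting 3/9 sends each of 1, 2, 4 to the other
    two, so the addition formula expresses each \<open>X\<^sub>i\<close> through one ratio and f 3 =
    1 / B.\<close>
  have X: "X\<^sub>1 * B\<^sup>2 = 1 + T * x\<^sup>2" "X\<^sub>2 * B\<^sup>2 = 1 + T * y\<^sup>2" "X\<^sub>3 * B\<^sup>2 = 1 + T * z\<^sup>2"
  proof -
    have "f 4 * f 2 = (f 3)\<^sup>2 * (f 1)\<^sup>2 * (1 + T * x\<^sup>2)"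
      using f_add[of 1 3] by (simp add: T_def h_def x_def)
    moreover have "f 4 * f 1 = (f 3)\<^sup>2 * (f 2)\<^sup>2 * (1 + T * y\<^sup>2)"
      using f_add[of 2 3] f_refl by (simp add: T_def h_def y_def)
    moreover have "f 2 * f 1 = (f 4)\<^sup>2 * (f 3)\<^sup>2 * (1 + T * z\<^sup>2)"
      using f_add[of 3 4] f_refl by (simp add: T_def h_def z_def mult_ac)
    moreover have "(f 3)\<^sup>2 * B\<^sup>2 = 1"
      using f3 by (simp flip: power_mult_distrib)
    ultimately show "X\<^sub>1 * B\<^sup>2 = 1 + T * x\<^sup>2" "X\<^sub>2 * B\<^sup>2 = 1 + T * y\<^sup>2" "X\<^sub>3 * B\<^sup>2 = 1 + T * z\<^sup>2"
      using f_pos[of 1] f_pos[of 2] f_pos[of 4]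
      unfolding X\<^sub>1_def X\<^sub>2_def X\<^sub>3_def times_divide_eq_left
      by (subst divide_eq_eq; simp; algebra)+
  qed
  have "X\<^sub>1 * B\<^sup>2 < X\<^sub>2 * B\<^sup>2" "X\<^sub>2 * B\<^sup>2 < X\<^sub>3 * B\<^sup>2"
    unfolding X using less T by simp_all
  thus "X\<^sub>1 < X\<^sub>2" "X\<^sub>2 < X\<^sub>3"
    using \<open>B > 0\<close> by simp_all
  show "X\<^sub>1 * X\<^sub>2 * X\<^sub>3 = 1"
    using f_pos[of 1] f_pos[of 2] f_pos[of 4]
    by (simp add: X\<^sub>1_def X\<^sub>2_def X\<^sub>3_def field_simps power2_eq_square)

  have p1: "x\<^sup>2 + y\<^sup>2 + z\<^sup>2 = T * E + 2 * T"
    using sym(1,2) unfolding E_def by algebra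
  have p2: "x\<^sup>2 * y\<^sup>2 + y\<^sup>2 * z\<^sup>2 + z\<^sup>2 * x\<^sup>2 = w - 2 * E"
    using sym(1,2) unfolding E_def w_def e_def by algebra
  have p3: "T * (x\<^sup>2 * y\<^sup>2 * z\<^sup>2) = E"
    unfolding E_def e_def by algebra

  have "B ^ 4 * (X\<^sub>1 + X\<^sub>2 + X\<^sub>3) = B ^ 4 * (B ^ 3 - 2 * B\<^sup>2 + 3 * B - 1 + A)"
    using X p1 E w w_def AB(1) by algebra
  thus "X\<^sub>1 + X\<^sub>2 + X\<^sub>3 = B ^ 3 - 2 * B\<^sup>2 + 3 * B - 1 + A"
    using \<open>B > 0\<close> by simp
  have "B ^ 4 * (X\<^sub>1 * X\<^sub>2 + X\<^sub>2 * X\<^sub>3 + X\<^sub>3 * X\<^sub>1) = B ^ 4 * (B\<^sup>2 + A)"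
  proof -
    have "B ^ 4 * (X\<^sub>1 * X\<^sub>2 + X\<^sub>2 * X\<^sub>3 + X\<^sub>3 * X\<^sub>1) =
      (X\<^sub>1 * B\<^sup>2) * (X\<^sub>2 * B\<^sup>2) + (X\<^sub>2 * B\<^sup>2) * (X\<^sub>3 * B\<^sup>2) + (X\<^sub>3 * B\<^sup>2) * (X\<^sub>1 * B\<^sup>2)"
      by algebra
    also have "\<dots> = 3 + 2 * T * (x\<^sup>2 + y\<^sup>2 + z\<^sup>2) + w * (x\<^sup>2 * y\<^sup>2 + y\<^sup>2 * z\<^sup>2 + z\<^sup>2 * x\<^sup>2)"
      unfolding X w_def by algebra
    also have "\<dots> = 3 + 4 * w + w\<^sup>2"
      unfolding p1 p2 w_def by algebra
    also have "\<dots> = B ^ 4 * (B\<^sup>2 + A)"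
    proof -
      have "B ^ 4 * (B\<^sup>2 + A) = B ^ 6 + B ^ 3 * (A * B)"
        by algebra
      thus ?thesis
        unfolding w AB(1) by algebra
    qed
    finally show ?thesis .
  qed
  thus "X\<^sub>1 * X\<^sub>2 + X\<^sub>2 * X\<^sub>3 + X\<^sub>3 * X\<^sub>1 = B\<^sup>2 + A"
    using \<open>B > 0\<close> by simp

  define P where "P = f 1 * f 2 * f 4"
  have "P > 0"
    using f_pos by (simp add: P_def)
  \<comment> \<open>Duplication runs through the cycle 1, 2, 4, 8, and f 8 = f 1 closes it;
    multiplying the three formulas gives P = P^4 D.\<close>
  define D where "D = (1 + x ^ 4) * (1 + y ^ 4) * (1 + z ^ 4)"
  have "f 2 = f 1 ^ 4 * (1 + x ^ 4)"
    using f_add[of 1 1] f0 by (simp add: x_def flip: power_add numeral_2_eq_2)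
  moreover have "f 4 = f 2 ^ 4 * (1 + y ^ 4)"
    using f_add[of 2 2] f0 by (simp add: y_def flip: power_add)
  moreover have "f 1 = f 4 ^ 4 * (1 + z ^ 4)"
    using f_add[of 4 4] f0 f_refl(4) by (simp add: z_def flip: power_add)
  ultimately have "P = P ^ 4 * D"
    unfolding P_def D_def by algebra
  hence "P * (P ^ 3 * D - 1) = 0"
    by algebra
  hence P: "P ^ 3 * D = 1"
    using \<open>P > 0\<close> by simp
  \<comment> \<open>\<open>D\<close> is the squared modulus of the product of the factors 1 + i x^2,
    1 + i y^2, 1 + i z^2.\<close>
  have "D = (1 - (w - 2 * E))\<^sup>2 + (x\<^sup>2 + y\<^sup>2 + z\<^sup>2 - x\<^sup>2 * y\<^sup>2 * z\<^sup>2)\<^sup>2"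
    unfolding D_def p2[symmetric] by algebra
  \<comment> \<open>The factor w = T^2 is absorbed into the second square, leaving only
    \<open>w\<close> and \<open>E\<close>.\<close>
  hence "w * D = w * (1 - (w - 2 * E))\<^sup>2 + (w * E + 2 * w - E)\<^sup>2"
    using p1 p3 w_def by algebra
  hence "w * (D * (B ^ 3 * (A + 1))) = w * (64 * (B - 1))"
    unfolding E w using AB(1) B6 by algebra
  hence "D * (B ^ 3 * (A + 1)) = 64 * (B - 1)"
    using T by (simp add: w_def)
  hence "P ^ 3 * (64 * (B - 1)) = B ^ 3 * (A + 1)"
    using P by algebra
  thus "(f 1 * f 2 * f 4) ^ 3 * (64 * (B - 1)) = B ^ 3 * (A + 1)"
    unfolding P_def .
qed

section \<open>The conjugates in the field of the ninth roots of unity\<close>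

text \<open>
  The three forms are conjugate under the cyclic Galois group of \<open>\<rat>(cos (\<pi>/9))\<close>, of which the roots of
  \<open>u\<^sup>3 = 3 u + 1\<close> are \<open>u\<close>, \<open>2 - u\<^sup>2\<close> and \<open>u\<^sup>2 - u - 2\<close>; hence their cyclic sums do not involve \<open>u\<close>.
\<close>

lemma conjugate_forms:
  fixes a m n u :: real
  assumes u: "u ^ 3 = 3 * u + 1"
  defines "\<alpha> \<equiv> a - m * u + n * (u\<^sup>2 - 2)"
    and "\<beta> \<equiv> a + m * (u - u\<^sup>2 + 2) - n * u"
    and "\<gamma> \<equiv> a + m * (u\<^sup>2 - 2) + n * (u - u\<^sup>2 + 2)"
  shows "\<alpha> * \<beta> * \<gamma> = a ^ 3 - 3 * a * m\<^sup>2 + 3 * a * m * n - 3 * a * n\<^sup>2 - m ^ 3 + 6 * m\<^sup>2 * n - 3 * m * n\<^sup>2 - n ^ 3"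
    and "\<alpha>\<^sup>2 * \<gamma> + \<beta>\<^sup>2 * \<alpha> + \<gamma>\<^sup>2 * \<beta> = 3 * a ^ 3 + 6 * m ^ 3 - 9 * m\<^sup>2 * n - 9 * m * n\<^sup>2 + 6 * n ^ 3"
    and "\<alpha>\<^sup>2 * \<beta> + \<beta>\<^sup>2 * \<gamma> + \<gamma>\<^sup>2 * \<alpha> = 3 * a ^ 3 - 3 * m ^ 3 - 9 * m\<^sup>2 * n + 18 * m * n\<^sup>2 - 3 * n ^ 3"
  using u unfolding \<alpha>_def \<beta>_def \<gamma>_def by algebra+

text \<open>Over the denominator \<alpha> \<beta> \<gamma> both sums are quotients of cubic forms in
  a, m, n. Homogeneity permits scaling by 2 B^2, which makes the arguments polynomials in
  \<open>B\<close> and reduces each claim to a polynomial division. The values are those in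
  \<open>theta3_norm_ninths\<close>.\<close>

lemma conjugate_ratios:
  fixes A B a m n u :: real
  assumes AB: "A * B = 2" "B ^ 6 + 4 * B ^ 3 = 8" and u: "u ^ 3 = 3 * u + 1"
    and a: "2 * B\<^sup>2 * a = 8 + 8 * B + 4 * B\<^sup>2 + B ^ 5"
    and m: "2 * B\<^sup>2 * m = 4 * B - 2 * B ^ 3"
    and n: "2 * B\<^sup>2 * n = 4 * B - 2 * B ^ 3 - B ^ 5"
  defines "\<alpha> \<equiv> a - m * u + n * (u\<^sup>2 - 2)"
    and "\<beta> \<equiv> a + m * (u - u\<^sup>2 + 2) - n * u"
    and "\<gamma> \<equiv> a + m * (u\<^sup>2 - 2) + n * (u - u\<^sup>2 + 2)"
  assumes nz: "\<alpha> \<noteq> 0" "\<beta> \<noteq> 0" "\<gamma> \<noteq> 0"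
  shows "\<alpha> / \<beta> + \<beta> / \<gamma> + \<gamma> / \<alpha> = B ^ 3 - 2 * B\<^sup>2 + 3 * B - 1 + A"
    and "\<alpha> / \<beta> * (\<beta> / \<gamma>) + \<beta> / \<gamma> * (\<gamma> / \<alpha>) + \<gamma> / \<alpha> * (\<alpha> / \<beta>) = B\<^sup>2 + A"
proof -
  define N U V where "N = (\<lambda>a m n :: real. a ^ 3 - 3 * a * m\<^sup>2 + 3 * a * m * n - 3 * a * n\<^sup>2 - m ^ 3 + 6 * m\<^sup>2 * n - 3 * m * n\<^sup>2 - n ^ 3)"
    and "U = (\<lambda>a m n :: real. 3 * a ^ 3 + 6 * m ^ 3 - 9 * m\<^sup>2 * n - 9 * m * n\<^sup>2 + 6 * n ^ 3)"
    and "V = (\<lambda>a m n :: real. 3 * a ^ 3 - 3 * m ^ 3 - 9 * m\<^sup>2 * n + 18 * m * n\<^sup>2 - 3 * n ^ 3)"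
  have hom: "N (c * a) (c * m) (c * n) = c ^ 3 * N a m n" "U (c * a) (c * m) (c * n) = c ^ 3 * U a m n"
    "V (c * a) (c * m) (c * n) = c ^ 3 * V a m n" for c
    unfolding N_def U_def V_def by algebra+
  have B: "B \<noteq> 0"
    using AB(1) by auto
  have S1: "B * (B ^ 3 - 2 * B\<^sup>2 + 3 * B - 1 + A) = 2 - B + 3 * B\<^sup>2 - 2 * B ^ 3 + B ^ 4"
    using AB(1) by (simp add: algebra_simps eval_nat_numeral)
  have S2: "B * (B\<^sup>2 + A) = 2 + B ^ 3"
    using AB(1) by (simp add: algebra_simps eval_nat_numeral)
  \<comment> \<open>The long factors below are the quotients of the division by the minimal polynomial \<open>B\<^sup>6 + 4 B\<^sup>3 - 8\<close> of \<open>B\<close>.\<close>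
  have "B * U (2 * B\<^sup>2 * a) (2 * B\<^sup>2 * m) (2 * B\<^sup>2 * n) -
        (2 - B + 3 * B\<^sup>2 - 2 * B ^ 3 + B ^ 4) * N (2 * B\<^sup>2 * a) (2 * B\<^sup>2 * m) (2 * B\<^sup>2 * n) =
        (128 + 128 * B - 96 * B ^ 2 - 160 * B ^ 3 - 136 * B ^ 4 - 72 * B ^ 5 + 12 * B ^ 6 + 12 * B ^ 7 +
         4 * B ^ 9 + 4 * B ^ 10 - 3 * B ^ 11 - 2 * B ^ 12 + B ^ 13) * (B ^ 6 + 4 * B ^ 3 - 8)"
    unfolding N_def U_def a m n by algebra
  hence "(2 * B\<^sup>2) ^ 3 * (B * U a m n - (2 - B + 3 * B\<^sup>2 - 2 * B ^ 3 + B ^ 4) * N a m n) = 0"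
    unfolding hom using AB(2) by (simp add: algebra_simps)
  hence "B * U a m n = (2 - B + 3 * B\<^sup>2 - 2 * B ^ 3 + B ^ 4) * N a m n"
    using B by simp
  hence U: "U a m n = (B ^ 3 - 2 * B\<^sup>2 + 3 * B - 1 + A) * N a m n"
    unfolding S1[symmetric] mult.assoc using B by simp
  have "B * V (2 * B\<^sup>2 * a) (2 * B\<^sup>2 * m) (2 * B\<^sup>2 * n) -
        (2 + B ^ 3) * N (2 * B\<^sup>2 * a) (2 * B\<^sup>2 * m) (2 * B\<^sup>2 * n) =
        (128 + 192 * B - 96 * B ^ 2 - 304 * B ^ 3 - 168 * B ^ 4 - 24 * B ^ 5 + 60 * B ^ 6 + 48 * B ^ 7 -
         6 * B ^ 8 - 2 * B ^ 9 + B ^ 12) * (B ^ 6 + 4 * B ^ 3 - 8)"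
    unfolding N_def V_def a m n by algebra
  hence "(2 * B\<^sup>2) ^ 3 * (B * V a m n - (2 + B ^ 3) * N a m n) = 0"
    unfolding hom using AB(2) by (simp add: algebra_simps)
  hence "B * V a m n = (2 + B ^ 3) * N a m n"
    using B by simp
  hence V: "V a m n = (B\<^sup>2 + A) * N a m n"
    unfolding S2[symmetric] mult.assoc using B by simp
  note forms = conjugate_forms[OF u, of a m n, folded \<alpha>_def \<beta>_def \<gamma>_def]
  have "\<alpha> / \<beta> + \<beta> / \<gamma> + \<gamma> / \<alpha> = (\<alpha>\<^sup>2 * \<gamma> + \<beta>\<^sup>2 * \<alpha> + \<gamma>\<^sup>2 * \<beta>) / (\<alpha> * \<beta> * \<gamma>)"
    using nz by (simp add: field_simps power2_eq_square)
  also have "\<dots> = B ^ 3 - 2 * B\<^sup>2 + 3 * B - 1 + A"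
    using U[unfolded U_def N_def, folded forms(1,2)] nz by (simp only: nonzero_mult_div_cancel_right mult_eq_0_iff simp_thms)
  finally show "\<alpha> / \<beta> + \<beta> / \<gamma> + \<gamma> / \<alpha> = B ^ 3 - 2 * B\<^sup>2 + 3 * B - 1 + A" .
  have "\<alpha> / \<beta> * (\<beta> / \<gamma>) + \<beta> / \<gamma> * (\<gamma> / \<alpha>) + \<gamma> / \<alpha> * (\<alpha> / \<beta>) =
        (\<alpha>\<^sup>2 * \<beta> + \<beta>\<^sup>2 * \<gamma> + \<gamma>\<^sup>2 * \<alpha>) / (\<alpha> * \<beta> * \<gamma>)"
    using nz by (simp add: field_simps power2_eq_square)
  also have "\<dots> = B\<^sup>2 + A"
    using V[unfolded V_def N_def, folded forms(1,3)] nz by (simp only: nonzero_mult_div_cancel_right mult_eq_0_iff simp_thms)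
  finally show "\<alpha> / \<beta> * (\<beta> / \<gamma>) + \<beta> / \<gamma> * (\<gamma> / \<alpha>) + \<gamma> / \<alpha> * (\<alpha> / \<beta>) = B\<^sup>2 + A" .
qed

text \<open>The forms are a - p1, a + p2, a + p3 with p1 > 1.2 and p2, p3 in (0, 1). The
  inequalities become \<alpha> \<gamma> < \<beta>^2 and \<alpha> \<beta> < \<gamma>^2, and a^2
  separates the two sides of each.\<close>

lemma conjugate_order:
  fixes a m n u :: real
  assumes u: "1.87 < u" "u < 1.88" and a: "9 < a"
    and m: "0.61 < m" "m < 0.64" and n: "-0.12 < n" "n < -0.09"
  defines "\<alpha> \<equiv> a - m * u + n * (u\<^sup>2 - 2)"
    and "\<beta> \<equiv> a + m * (u - u\<^sup>2 + 2) - n * u"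
    and "\<gamma> \<equiv> a + m * (u\<^sup>2 - 2) + n * (u - u\<^sup>2 + 2)"
  shows "\<alpha> > 0" "\<beta> > 0" "\<gamma> > 0" "\<alpha> / \<beta> < \<beta> / \<gamma>" "\<beta> / \<gamma> < \<gamma> / \<alpha>"
proof -
  have u2: "u\<^sup>2 > 3.4969" "u\<^sup>2 < 3.5344"
  proof -
    have "1.87 * 1.87 < u * u" "u * u < 1.88 * 1.88"
      using u by (intro mult_strict_mono; simp)+
    thus "u\<^sup>2 > 3.4969" "u\<^sup>2 < 3.5344" by (simp_all add: power2_eq_square)
  qed
  \<comment> \<open>For u = 2 cos (pi / 9) these are 2 cos (2 pi / 9) and 2 cos (4 pi / 9).\<close>
  define y\<^sub>1 y\<^sub>2 where "y\<^sub>1 = u\<^sup>2 - 2" and "y\<^sub>2 = u - u\<^sup>2 + 2"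
  have y: "1.49 < y\<^sub>1" "y\<^sub>1 < 1.54" "0.33 < y\<^sub>2" "y\<^sub>2 < 0.39"
    using u u2 by (simp_all add: y\<^sub>1_def y\<^sub>2_def)
  define k where "k = - n"
  have k: "0.09 < k" "k < 0.12" using n by (simp_all add: k_def)
  define p\<^sub>1 p\<^sub>2 p\<^sub>3 where "p\<^sub>1 = m * u + k * y\<^sub>1" and "p\<^sub>2 = m * y\<^sub>2 + k * u" and "p\<^sub>3 = m * y\<^sub>1 - k * y\<^sub>2"
  have bounds: "l * l' < s * t \<and> s * t < h * h'"
    if "l < s" "s < h" "l' < t" "t < h'" "0 < l" "0 < l'" for l s h l' t h' :: real
    using that by (auto intro!: mult_strict_mono)
  have "p\<^sub>1 > 1.2" "p\<^sub>1 < 1.5"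
    using bounds[OF m u] bounds[OF k y(1,2)] by (simp_all add: p\<^sub>1_def)
  moreover have "p\<^sub>2 > 0" "p\<^sub>2 < 1"
    using bounds[OF m y(3,4)] bounds[OF k u] by (simp_all add: p\<^sub>2_def)
  moreover have "p\<^sub>3 > 0" "p\<^sub>3 < 1"
    using bounds[OF m y(1,2)] bounds[OF k y(3,4)] by (simp_all add: p\<^sub>3_def)
  moreover have forms: "\<alpha> = a - p\<^sub>1" "\<beta> = a + p\<^sub>2" "\<gamma> = a + p\<^sub>3"
    by (simp_all add: \<alpha>_def \<beta>_def \<gamma>_def p\<^sub>1_def p\<^sub>2_def p\<^sub>3_def k_def y\<^sub>1_def y\<^sub>2_def)
  ultimately show pos: "\<alpha> > 0" "\<beta> > 0" "\<gamma> > 0" using a by simp_all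
  have less: "(a - p\<^sub>1) * (a + q) < (a + r) * (a + r)" if "0 < q" "q < p\<^sub>1" "0 < r" for q r
  proof -
    have "(a - p\<^sub>1) * (a + q) = a * a - a * (p\<^sub>1 - q) - p\<^sub>1 * q"
      by (simp add: algebra_simps)
    also have "\<dots> < a * a"
      using that a by (smt (verit) mult_pos_pos)
    also have "\<dots> < (a + r) * (a + r)"
      using that a by (intro mult_strict_mono) auto
    finally show ?thesis .
  qed
  show "\<alpha> / \<beta> < \<beta> / \<gamma>"
    using less[of p\<^sub>3 p\<^sub>2] \<open>p\<^sub>1 > 1.2\<close> \<open>p\<^sub>3 > 0\<close> \<open>p\<^sub>3 < 1\<close> \<open>p\<^sub>2 > 0\<close> pos
    by (simp add: forms divide_less_eq less_divide_eq mult_ac)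
  show "\<beta> / \<gamma> < \<gamma> / \<alpha>"
    using less[of p\<^sub>2 p\<^sub>3] \<open>p\<^sub>1 > 1.2\<close> \<open>p\<^sub>2 > 0\<close> \<open>p\<^sub>2 < 1\<close> \<open>p\<^sub>3 > 0\<close> pos
    by (simp add: forms divide_less_eq less_divide_eq mult_ac)
qed

section \<open>Return to phi and evaluation of the radicals\<close>

lemma ramanujan_phi_exp: "t > 0 \<Longrightarrow> ramanujan_phi (exp (- t)) = theta3 t 0"
proof -
  assume t: "t > 0"
  have "exp (- t) powi (n\<^sup>2) = exp (- t * (of_int n + 0)\<^sup>2)" for n :: int
    by (simp add: exp_power_int mult_ac)
  moreover have "theta3 t 0 = (\<Sum>\<^sub>\<infinity>n::int. Re (exp (- t * (of_int n + 0)\<^sup>2) *\<^sub>R cis (2 * pi * (of_int n + 0) * 0)))"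
    unfolding theta3_def theta_def
    by (rule infsum_Re[symmetric]) (rule abs_summable_summable[OF abs_summable_theta[OF t]])
  ultimately show ?thesis
    by (simp add: ramanujan_phi_def)
qed

lemma ramanujan_phi_ratio:
  "ramanujan_phi (exp (- 81 * pi)) / ramanujan_phi (exp (- pi)) =
     1 / 9 * (1 + 2 * theta3_norm (1 / 9) + 2 * theta3_norm (2 / 9) + 2 * theta3_norm (3 / 9) + 2 * theta3_norm (4 / 9))"
proof -
  have "complex_of_real (\<Sum>k<9. theta3 pi (real k / 9)) = of_real (9 * theta3 (81 * pi) 0)"
    using sum_theta_torsion[of pi 9] unfolding of_real_sum of_real_mult of_real_theta3 by (simp add: mult.commute)
  hence sum: "(\<Sum>k<9. theta3 pi (real k / 9)) = 9 * theta3 (81 * pi) 0"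
    by (simp only: of_real_eq_iff)
  have refl: "theta3 pi (8 / 9) = theta3 pi (1 / 9)" "theta3 pi (7 / 9) = theta3 pi (2 / 9)"
    "theta3 pi (6 / 9) = theta3 pi (3 / 9)" "theta3 pi (5 / 9) = theta3 pi (4 / 9)"
    using theta3_reflect[of pi "1 / 9"] theta3_reflect[of pi "2 / 9"]
      theta3_reflect[of pi "3 / 9"] theta3_reflect[of pi "4 / 9"] by simp_all
  have "(\<Sum>k<9. theta3 pi (real k / 9)) =
     theta3 pi 0 + 2 * (theta3 pi (1 / 9) + theta3 pi (2 / 9) + theta3 pi (3 / 9) + theta3 pi (4 / 9))"
    using refl by (simp add: eval_nat_numeral)
  moreover have "theta3 pi 0 > 0"
    by (intro theta3_pi_pos) auto
  moreover have "ramanujan_phi (exp (- 81 * pi)) = theta3 (81 * pi) 0" "ramanujan_phi (exp (- pi)) = theta3 pi 0"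
    using ramanujan_phi_exp[of "81 * pi"] ramanujan_phi_exp[of pi] by simp_all
  ultimately show ?thesis
    using sum by (simp add: theta3_norm_def field_simps)
qed

lemma cube_less_imp_less: "x < y" if "x ^ 3 < y ^ 3" "y \<ge> 0" for x y :: real
  using that power_less_imp_less_base by blast

lemma two_cos_pi_ninth:
  defines "u \<equiv> 2 * cos (pi / 9)"
  shows "u ^ 3 = 3 * u + 1" and "1.87 < u" and "u < 1.88"
proof -
  have "cos (3 * (pi / 9)) = 1 / 2"
    by (simp add: cos_60)
  thus cubic: "u ^ 3 = 3 * u + 1"
    unfolding cos_treble_cos u_def by (simp add: power_mult_distrib)
  have "cos (pi / 9) > cos (pi / 3)"
    by (intro cos_monotone_0_pi) auto
  hence u: "u > 1" by (simp add: u_def cos_60)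
  \<comment> \<open>Division of u^3 - 3 u - 1 by u - 1.87, with 0.4969 = 1.87^2 - 3; as the
    quadratic factor is positive, the remainder decides the sign.\<close>
  have "(u - 1.87) * (u\<^sup>2 + 1.87 * u + 0.4969) = 0.070797 "
    using cubic by (simp add: power2_eq_square power3_eq_cube field_simps)
  moreover have "u\<^sup>2 + 1.87 * u + 0.4969 > 0"
    using u by (intro add_pos_pos) auto
  ultimately have "0 < u - 1.87"
    by (intro zero_less_mult_pos2[of "u - 1.87" "u\<^sup>2 + 1.87 * u + 0.4969"]) simp_all
  thus "1.87 < u" by simp
  have "(1.88 - u) * (u\<^sup>2 + 1.88 * u + 0.5344) = 0.004672"
    using cubic by (simp add: power2_eq_square power3_eq_cube field_simps)
  moreover have "u\<^sup>2 + 1.88 * u + 0.5344 > 0"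
    using u by (intro add_pos_pos) auto
  ultimately have "0 < 1.88 - u"
    by (intro zero_less_mult_pos2[of "1.88 - u" "u\<^sup>2 + 1.88 * u + 0.5344"]) simp_all
  thus "u < 1.88" by simp
qed

theorem theorem4p12:
  fixes p a b c d \<alpha> \<beta> \<gamma> u\<^sub>1 u\<^sub>2 u\<^sub>3 u\<^sub>4 :: real
  assumes "p = 2 * root 3 (2 * (sqrt 3 - 1) *
                  ((root 3 (2 * (sqrt 3 + 1)) + 1) / (root 3 (2 * (sqrt 3 - 1)) - 1)))"
    and "a = 2 * root 3 (2 * (sqrt 3 + 1)) + (root 3 (2 * (sqrt 3 + 1)))\<^sup>2 + sqrt 3 + 1"
    and "b = 2 * (root 3 (2 * (sqrt 3 + 1)) - root 3 (2 * (sqrt 3 - 1)))"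
    and "c = 2 * (root 3 (2 * (sqrt 3 - 1)) - root 3 (2 * (sqrt 3 + 1)) + sqrt 3 - 1)"
    and "d = 2 * (sqrt 3 - 1)"
    and "\<alpha> = 2 / 3 * (a - b * cos (pi / 9) - c * cos (2 * pi / 9))"
    and "\<beta> = 2 / 3 * (a + d * cos (pi / 9) - b * cos (2 * pi / 9))"
    and "\<gamma> = 2 / 3 * (a - c * cos (pi / 9) + d * cos (2 * pi / 9))"
    and "u\<^sub>1 = root 3 (\<beta> * p / \<alpha>)"
    and "u\<^sub>2 = root 3 (\<gamma> * p / \<beta>)"
    and "u\<^sub>3 = root 3 (2 * (sqrt 3 + 1))"
    and "u\<^sub>4 = root 3 (\<alpha> * p / \<gamma>)"
  shows "ramanujan_phi (exp (- 81 * pi)) / ramanujan_phi (exp (- pi)) =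
           1 / 9 * (1 + u\<^sub>1 + u\<^sub>2 + u\<^sub>3 + u\<^sub>4)"
proof -
  define A B u where "A = root 3 (2 * (sqrt 3 + 1))" and "B = root 3 (2 * (sqrt 3 - 1))"
    and "u = 2 * cos (pi / 9)"
  have sqrt3: "1.732 < sqrt 3" "sqrt 3 < 1.7325"
    by (rule real_less_rsqrt real_less_lsqrt; simp add: power2_eq_square)+
  have A3: "A ^ 3 = 2 * (sqrt 3 + 1)" and B3: "B ^ 3 = 2 * (sqrt 3 - 1)"
    by (simp_all add: A_def B_def odd_real_root_pow)
  have "A * B = root 3 (2 ^ 3)"
    unfolding A_def B_def real_root_mult[symmetric] by (simp add: algebra_simps)
  hence AB: "A * B = 2"
    by (simp only: real_root_power_cancel zero_le_numeral zero_less_numeral)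
  have B6: "B ^ 6 + 4 * B ^ 3 = 8"
  proof -
    have "B ^ 6 = (B ^ 3)\<^sup>2" by (simp flip: power_mult)
    thus ?thesis unfolding B3 by (simp add: power2_eq_square algebra_simps)
  qed
  have B: "1.13 < B" "B < 1.14"
  proof -
    show "1.13 < B"
    proof (rule cube_less_imp_less)
      show "1.13 ^ 3 < B ^ 3" unfolding B3 using sqrt3 by (simp add: power3_eq_cube)
    qed (simp add: B_def)
    show "B < 1.14"
    proof (rule cube_less_imp_less)
      show "B ^ 3 < 1.14 ^ 3" unfolding B3 using sqrt3 by (simp add: power3_eq_cube)
    qed simp
  qed
  have A: "1.754 < A" "A < 1.77"
  proof -
    have "1.754 * B < A * B" "A * B < 1.77 * B"
      unfolding AB using B by simp_all
    thus "1.754 < A" "A < 1.77"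
      using B by (simp_all only: mult_less_cancel_right)
  qed

  \<comment> \<open>The conjugate forms need d = 2 (m - n), that is d = b + c. This holds for
    \<open>c\<close> as assumed here, with \<open>+ sqrt 3 - 1\<close>; the English sentence has
    \<open>- sqrt 3 - 1\<close> there.\<close>
  define m n where "m = b / 2" and "n = - c / 2"
  have a: "a = 2 * A + A\<^sup>2 + B ^ 3 / 2 + 2" and m: "m = A - B" and n: "n = A - B - B ^ 3 / 2"
    and d: "d = 2 * (m - n)"
    using assms(2-5) B3 by (simp_all add: m_def n_def A_def B_def field_simps)
  have ABk: "B\<^sup>2 * A = 2 * B" "B\<^sup>2 * A\<^sup>2 = 4"
  proof -
    have "B\<^sup>2 * A = B * (A * B)" "B\<^sup>2 * A\<^sup>2 = (A * B)\<^sup>2"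
      by algebra+
    thus "B\<^sup>2 * A = 2 * B" "B\<^sup>2 * A\<^sup>2 = 4"
      unfolding AB by simp_all
  qed
  have scaled: "2 * B\<^sup>2 * a = 8 + 8 * B + 4 * B\<^sup>2 + B ^ 5" "2 * B\<^sup>2 * m = 4 * B - 2 * B ^ 3"
    "2 * B\<^sup>2 * n = 4 * B - 2 * B ^ 3 - B ^ 5"
    unfolding a m n using ABk by algebra+
  have "a > 9"
  proof -
    have "A\<^sup>2 > 1.754 * 1.754"
      unfolding power2_eq_square using A by (intro mult_strict_mono) auto
    thus ?thesis unfolding a B3 using A sqrt3 by (simp add: field_simps)
  qed
  have m_bounds: "0.61 < m" "m < 0.64" and n_bounds: "-0.12 < n" "n < -0.09"
    unfolding m n B3 using A B sqrt3 by (simp_all add: field_simps)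

  define al be ga where "al = a - m * u + n * (u\<^sup>2 - 2)" and "be = a + m * (u - u\<^sup>2 + 2) - n * u"
    and "ga = a + m * (u\<^sup>2 - 2) + n * (u - u\<^sup>2 + 2)"
  have cos1: "cos (pi / 9) = u / 2"
    by (simp add: u_def)
  have cos2: "cos (2 * pi / 9) = (u\<^sup>2 - 2) / 2"
    using cos_double_cos[of "pi / 9"] by (simp add: u_def power_mult_distrib)
  have \<alpha>\<beta>\<gamma>: "\<alpha> = 2 / 3 * al" "\<beta> = 2 / 3 * be" "\<gamma> = 2 / 3 * ga"
    unfolding assms(6-8) al_def be_def ga_def d m_def n_def cos1 cos2
    by (simp_all add: field_simps)
  note cubic = two_cos_pi_ninth[folded u_def]
  note order = conjugate_order[OF cubic(2,3) \<open>a > 9\<close> m_bounds n_bounds, folded al_def be_def ga_def]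
  note ratios = conjugate_ratios[OF AB B6 cubic(1) scaled, folded al_def be_def ga_def]

  define f where "f k = theta3_norm (real k / 9)" for k :: nat
  define P where "P = f 1 * f 2 * f 4"
  have f: "f k > 0" if "k \<le> 9" for k
    unfolding f_def using that by (intro theta3_norm_pos) auto
  hence "P > 0" by (simp add: P_def)
  note ninths = theta3_norm_ninths[OF AB A3 B3, folded f_def]
  have nz: "al \<noteq> 0" "be \<noteq> 0" "ga \<noteq> 0"
    using order(1-3) by simp_all
  have "f 2 * f 4 / (f 1)\<^sup>2 = al / be \<and> f 1 * f 4 / (f 2)\<^sup>2 = be / ga \<and> f 1 * f 2 / (f 4)\<^sup>2 = ga / al"
  proof (rule sorted_cubic_roots_unique)
    show "f 2 * f 4 / (f 1)\<^sup>2 * (f 1 * f 4 / (f 2)\<^sup>2) * (f 1 * f 2 / (f 4)\<^sup>2) = al / be * (be / ga) * (ga / al)"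
      using ninths(4) nz by simp
  qed (use ninths order ratios[OF nz] in simp_all)
  \<comment> \<open>Each ratio is \<open>P\<close> over a cube, so it determines the cube of f k
    once \<open>P\<close> is known.\<close>
  moreover have "P / f 1 ^ 3 = f 2 * f 4 / (f 1)\<^sup>2" "P / f 2 ^ 3 = f 1 * f 4 / (f 2)\<^sup>2"
    "P / f 4 ^ 3 = f 1 * f 2 / (f 4)\<^sup>2"
    using f[of 1] f[of 2] f[of 4] by (simp_all add: P_def power2_eq_square power3_eq_cube)
  ultimately have quot: "P / f 1 ^ 3 = \<alpha> / \<beta>" "P / f 2 ^ 3 = \<beta> / \<gamma>" "P / f 4 ^ 3 = \<gamma> / \<alpha>"
    unfolding \<alpha>\<beta>\<gamma> by simp_all
  have pos: "\<alpha> > 0" "\<beta> > 0" "\<gamma> > 0"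
    unfolding \<alpha>\<beta>\<gamma> using order(1-3) by simp_all

  \<comment> \<open>The radicand in \<open>p\<close> is the cube of 4 P; with p = 8 P the radicands
    of \<open>u\<^sub>1\<close>, \<open>u\<^sub>2\<close>, \<open>u\<^sub>4\<close> become cubes of
    2 f k.\<close>
  have "2 * (sqrt 3 - 1) * ((A + 1) / (B - 1)) = (4 * P) ^ 3"
    using ninths(7) B unfolding B3[symmetric] P_def[symmetric] by (simp add: field_simps)
  hence "p = 2 * root 3 ((4 * P) ^ 3)"
    unfolding assms(1) A_def[symmetric] B_def[symmetric] by (simp only:)
  also have "root 3 ((4 * P) ^ 3) = 4 * P"
    using \<open>P > 0\<close> by (intro real_root_power_cancel) auto
  finally have p: "p = 8 * P" by simp

  have cube_root: "root 3 (y * p / x) = 2 * f k" if "P / f k ^ 3 = x / y" "x > 0" "y > 0" "k \<le> 9" for x y k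
  proof -
    have "y * p / x = (2 * f k) ^ 3"
      using that f[of k] \<open>P > 0\<close> by (simp add: p field_simps)
    moreover have "root 3 ((2 * f k) ^ 3) = 2 * f k"
      using f[OF that(4)] by (intro real_root_power_cancel) auto
    ultimately show ?thesis by (simp only:)
  qed
  have "u\<^sub>1 = 2 * f 1" "u\<^sub>2 = 2 * f 2" "u\<^sub>4 = 2 * f 4"
    unfolding assms(9,10,12) using quot pos by (auto intro!: cube_root)
  moreover have "u\<^sub>3 = 2 * f 3"
  proof -
    have "A * B = 2 * f 3 * B"
      using AB ninths(1) by simp
    hence "A = 2 * f 3"
      using B by simp
    thus ?thesis
      by (simp only: assms(11) A_def)
  qed
  ultimately show ?thesis
    unfolding ramanujan_phi_ratio by (simp add: f_def)
qed

end
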